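(* In the setting described in the context, with $f\equiv0$, assume condition (i), condition (ii), and $\tau\le T_{2n}$ for all $n\in\mathbb N$. Assume there is $\overline T>0$ such that for every $T>\overline T$ there is a constant $c>0$ (depending on $T$, not on the data) with $$\tfrac12\big(\|w_0\|_V^2+\|w_1\|_H^2\big)\le c\int_0^T\|w_t(s)\|_W^2\,ds$$ for every weak solution $w$ of $w_{tt}+Aw=0$, $w(0)=w_0\in V$, $w_t(0)=w_1\in H$; and that $T^*:=\inf_nT_{2n}>\overline T$. Let $c$ be the constant corresponding to $T=T^*$, $C$ the embedding constant in $\|u\|_W^2\le C\|u\|_H^2$, and $$\hat c_n=\frac{2c(1+4C^2T_{2n}^2M_{2n}^2)}{m_{2n}+2c(1+4C^2T_{2n}^2M_{2n}^2)}.$$ If $$\sum_{n=0}^\infty\Big[2CM_{2n+1}T_{2n+1}+\ln\big(\hat c_n+CM_{2n+1}T_{2n+1}\big)\Big]=-\infty,$$ then every solution $u$ of $u_{tt}(t)+Au(t)+B_1(t)B_1^*(t)u_t(t)+B_2(t)B_2^*(t)u_t(t-\tau)=0$, $t>0$, $u(0)=u_0\in V$, $u_t(0)=u_1\in H$, satisfies $E_S(t)=\frac12(\|u(t)\|_V^2+\|u_t(t)\|_H^2)\to0$ as $t\to+\infty$.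
   Context: $H$ is a real Hilbert space, $A:\mathcal D(A)\to H$ a densely defined, self-adjoint, positive, coercive linear operator, $V=\mathcal D(A^{1/2})$ with $\|v\|_V=\|A^{1/2}v\|_H$, $V\hookrightarrow H\equiv H'\hookrightarrow V'$ densely. $U_1,U_2$ are real Hilbert spaces, $B_i(t)\in\mathcal L(U_i,H)$ with $B_1^*(t)B_2^*(t)=0$ for $t>0$. There is a sequence $0=t_0<t_1<\cdots$; $I_n=[t_n,t_{n+1})$, $T_n=t_{n+1}-t_n$; $B_2=0$ on $I_{2n}$, $B_1=0$ on $I_{2n+1}$, $B_1\in C^1([t_{2n},t_{2n+1}];\mathcal L(U_1,H))$, $B_2\in C^1([t_{2n+1},t_{2n+2}];\mathcal L(U_2,H))$. $\tau>0$ is the delay. $W$ is a Hilbert space with $\|u\|_W^2\le C\|u\|_H^2$ for $u\in H$. (i): for every $n$ there are $0<m_{2n}\le M_{2n}$ with $m_{2n}\|u\|_W^2\le\|B_1^*(t)u\|_{U_1}^2\le M_{2n}\|u\|_W^2$ for $u\in H$, $t\in I_{2n}$. (ii): there is $M_{2n+1}>0$ with $\|B_2^*(t)u\|_{U_2}^2\le M_{2n+1}\|u\|_W^2$ for $u\in H$, $t\in I_{2n+1}$. *)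

theory Defs
  imports "HOL-Analysis.Analysis"
begin

definition self_adjoint_op :: "'h::{real_inner,complete_space} set \<Rightarrow> ('h \<Rightarrow> 'h) \<Rightarrow> bool" where
  "self_adjoint_op D A \<longleftrightarrow>
     subspace D \<and> closure D = UNIV \<and>
     (\<forall>x\<in>D. \<forall>y\<in>D. A (x + y) = A x + A y) \<and>
     (\<forall>x\<in>D. \<forall>c. A (c *\<^sub>R x) = c *\<^sub>R A x) \<and>
     {y. \<exists>z. \<forall>x\<in>D. A x \<bullet> y = x \<bullet> z} = D \<and>
     (\<forall>x\<in>D. \<forall>y\<in>D. A x \<bullet> y = x \<bullet> A y)"

definition positive_op :: "'h::real_inner set \<Rightarrow> ('h \<Rightarrow> 'h) \<Rightarrow> bool" where
  "positive_op D A \<longleftrightarrow> (\<forall>x\<in>D. 0 \<le> A x \<bullet> x)"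

definition coercive_op :: "'h::real_inner set \<Rightarrow> ('h \<Rightarrow> 'h) \<Rightarrow> bool" where
  "coercive_op D A \<longleftrightarrow> (\<exists>\<alpha>>0. \<forall>x\<in>D. \<alpha> * (norm x)\<^sup>2 \<le> A x \<bullet> x)"

text \<open>(DS, S) is the positive self-adjoint square root of (D, A): A = S o S with
  D(A) = {x in D(S). S x in D(S)}.  Then V = D(A^(1/2)) = DS and the V-norm is norm (S v).\<close>

definition pos_sqrt_op :: "'h::{real_inner,complete_space} set \<Rightarrow> ('h \<Rightarrow> 'h) \<Rightarrow> 'h set \<Rightarrow> ('h \<Rightarrow> 'h) \<Rightarrow> bool" where
  "pos_sqrt_op D A DS S \<longleftrightarrow>
     self_adjoint_op DS S \<and> positive_op DS S \<and>
     D = {x\<in>DS. S x \<in> DS} \<and> (\<forall>x\<in>D. S (S x) = A x)"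

text \<open>Weak (finite energy) solution of w'' + A w = 0, w(0) = w0, w'(0) = w1 on [0, infinity):
  w in C([0,inf);V) and C^1([0,inf);H), with derivative w', and for every v in V
  <w'(t),v> - <w1,v> + int_0^t a(w(s),v) ds = 0, where a(u,v) = <A^(1/2)u, A^(1/2)v>.\<close>

definition wave_weak_sol :: "'h::{real_inner,complete_space} set \<Rightarrow> ('h \<Rightarrow> 'h)
     \<Rightarrow> (real \<Rightarrow> 'h) \<Rightarrow> (real \<Rightarrow> 'h) \<Rightarrow> 'h \<Rightarrow> 'h \<Rightarrow> bool" where
  "wave_weak_sol DS S w w' w0 w1 \<longleftrightarrow>
     (\<forall>t\<ge>0. w t \<in> DS) \<and>
     continuous_on {0..} w \<and> continuous_on {0..} (\<lambda>t. S (w t)) \<and>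
     (\<forall>t\<ge>0. (w has_vector_derivative w' t) (at t within {0..})) \<and>
     continuous_on {0..} w' \<and>
     w 0 = w0 \<and> w' 0 = w1 \<and>
     (\<forall>v\<in>DS. \<forall>t\<ge>0.
        ((\<lambda>s. S (w s) \<bullet> S v) has_integral (w1 \<bullet> v - w' t \<bullet> v)) {0..t})"

definition delay_weak_sol :: "'h::{real_inner,complete_space} set \<Rightarrow> ('h \<Rightarrow> 'h)
     \<Rightarrow> (real \<Rightarrow> ('u1::{real_inner,complete_space} \<Rightarrow>\<^sub>L 'h)) \<Rightarrow> (real \<Rightarrow> 'h \<Rightarrow> 'u1)
     \<Rightarrow> (real \<Rightarrow> ('u2::{real_inner,complete_space} \<Rightarrow>\<^sub>L 'h)) \<Rightarrow> (real \<Rightarrow> 'h \<Rightarrow> 'u2)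
     \<Rightarrow> real \<Rightarrow> (real \<Rightarrow> 'h) \<Rightarrow> (real \<Rightarrow> 'h) \<Rightarrow> 'h \<Rightarrow> 'h \<Rightarrow> bool" where
  "delay_weak_sol DS S B1 B1adj B2 B2adj \<tau> u u' u0 u1 \<longleftrightarrow>
     (\<forall>t\<ge>0. u t \<in> DS) \<and>
     continuous_on {0..} u \<and> continuous_on {0..} (\<lambda>t. S (u t)) \<and>
     (\<forall>t\<ge>0. (u has_vector_derivative u' t) (at t within {0..})) \<and>
     continuous_on {0..} u' \<and>
     u 0 = u0 \<and> u' 0 = u1 \<and>
     (\<forall>v\<in>DS. \<forall>t\<ge>0.
        ((\<lambda>s. S (u s) \<bullet> S v
              + blinfun_apply (B1 s) (B1adj s (u' s)) \<bullet> v
              + blinfun_apply (B2 s) (B2adj s (u' (s - \<tau>))) \<bullet> v)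
          has_integral (u1 \<bullet> v - u' t \<bullet> v)) {0..t})"

end

theory Submission
  imports Defs
begin

text \<open>
  On an interval where only the instantaneous feedback acts, u is compared with the free wave w
  having the same data at the left end point. The difference is driven by the bounded feedback,
  so the observability inequality for w carries over to u and yields a fixed loss factor of the
  energy. On an interval where only the delayed feedback acts, a Gronwall estimate bounds the
  growth, the delay reaching back no further than the preceding damped interval. The product of
  the factors tends to zero by the assumption on the series.

  Existence of the free wave and the energy identity for weak solutions both come from the
  skew-adjoint operator (p, q) \<mapsto> (Sq, - Sp) on H \<times> H, with p = Su and q = u': its resolvents are
  contractions that regularise weak solutions, and its Yosida approximations generate
  flows that converge locally uniformly.

  The sort of H, \<open>{real_inner,complete_space}\<close>, is not a subsort of \<open>banach\<close>, so vector-valued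
  integration is not available in H; all H-valued integrals are expressed weakly, tested against
  vectors.
\<close>

section \<open>Hilbert space preliminaries\<close>

text \<open>The velocity of a finite energy solution is only known to lie in H, not in V, so it is
  not an admissible test vector; this is what forces the resolvent regularisation. The feedback
  switches at the nodes, so its continuity is available only on half-open intervals: estimates are
  proved on \<open>{a..<b}\<close> and reach \<open>b\<close> by continuity of the energy. The loss
  factor rests on the observed quantity I, the integral of |\<iota> u'|^2 over a damped interval of
  length L. Dissipation gives m I \<le> E(a) - E(b). The velocities of u and of the free wave differ
  by a term with square at most 4 L C M^2 I, so observability gives E(a) \<le> K I with K = 2c(1 + 4
  C^2 L^2 M^2). Eliminating I yields E(b) \<le> K/(m + K) E(a), which is the constant
  \<open>chat\<close>. On the delayed interval the coupling costs C M (E(s) + E(s - \<tau>)): the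
  history contributes the summand C M T beside \<open>chat\<close>, and the two copies of the energy
  give the 2 in the exponent. The terms of the series are the logarithms of these combined
  factors.\<close>

lemma closed_subspace_orthogonal:
  fixes M :: "'a::{real_inner,complete_space} set"
  assumes sub: "subspace M" and cl: "closed M" and ne: "M \<noteq> UNIV"
  obtains y where "y \<noteq> 0" "\<And>x. x \<in> M \<Longrightarrow> x \<bullet> y = 0"
proof -
  obtain z where z: "z \<notin> M" using ne by blast
  define d where "d = (INF x\<in>M. (norm (z - x))\<^sup>2)"
  have bdd: "bdd_below ((\<lambda>x. (norm (z - x))\<^sup>2) ` M)"
    by (rule bdd_belowI[of _ 0]) auto
  have M0: "0 \<in> M" using sub by (rule subspace_0)
  have d_le: "d \<le> (norm (z - x))\<^sup>2" if "x \<in> M" for x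
    unfolding d_def using bdd that by (rule cINF_lower)
  have "\<exists>x\<in>M. (norm (z - x))\<^sup>2 < d + inverse (real (Suc n))" for n
  proof -
    have "d < d + inverse (real (Suc n))" by simp
    then show ?thesis
      unfolding d_def using M0 bdd by (subst (asm) cINF_less_iff) auto
  qed
  then obtain x where xM: "\<And>n. x n \<in> M"
    and xd: "\<And>n. (norm (z - x n))\<^sup>2 < d + inverse (real (Suc n))" by metis
  have near: "(norm (x k - x l))\<^sup>2 \<le> 2 * inverse (real (Suc k)) + 2 * inverse (real (Suc l))" for k l
  proof -
    have "(1/2) *\<^sub>R (x k + x l) \<in> M"
      using sub xM by (simp add: subspace_add subspace_scale)
    then have "d \<le> (norm (z - (1/2) *\<^sub>R (x k + x l)))\<^sup>2" by (rule d_le)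
    \<comment> \<open>Parallelogram law for z - x k and z - x l: the midpoint lies in M, so its
      squared distance is at least d, and near-minimisers are close to each other.\<close>
    moreover have "(norm (x k - x l))\<^sup>2 = 2 * (norm (z - x k))\<^sup>2 + 2 * (norm (z - x l))\<^sup>2
        - 4 * (norm (z - (1/2) *\<^sub>R (x k + x l)))\<^sup>2"
      unfolding power2_norm_eq_inner by (simp add: algebra_simps inner_commute)
    moreover have "n \<le> 2 * r + 2 * s"
      if "d \<le> p" "n = 2 * a + 2 * b - 4 * p" "a < d + r" "b < d + s" for n p a b r s :: real
      using that by linarith
    ultimately show ?thesis using xd[of k] xd[of l] by blast
  qed
  have "Cauchy x"
  proof (rule metric_CauchyI)
    fix e :: real assume e: "0 < e"
    then obtain N where N: "inverse (real (Suc N)) < e\<^sup>2 / 4"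
      using reals_Archimedean[of "e\<^sup>2 / 4"] by auto
    show "\<exists>N. \<forall>k\<ge>N. \<forall>l\<ge>N. dist (x k) (x l) < e"
    proof (intro exI allI impI)
      fix k l assume "N \<le> k" "N \<le> l"
      then have "inverse (real (Suc k)) \<le> inverse (real (Suc N))"
        "inverse (real (Suc l)) \<le> inverse (real (Suc N))" by (auto intro!: le_imp_inverse_le)
      then have "(norm (x k - x l))\<^sup>2 < e\<^sup>2" using near[of k l] N by linarith
      then show "dist (x k) (x l) < e"
        using e by (simp add: dist_norm power2_less_imp_less)
    qed
  qed
  then obtain p where p: "x \<longlonglongrightarrow> p" using Cauchy_convergent convergent_def by blast
  have pM: "p \<in> M" using cl p xM closed_sequentially by blast
  have "(\<lambda>n. (norm (z - x n))\<^sup>2) \<longlonglongrightarrow> (norm (z - p))\<^sup>2"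
    by (intro tendsto_intros p)
  moreover have "(\<lambda>n. d + inverse (real (Suc n))) \<longlonglongrightarrow> d + 0"
    by (intro tendsto_intros LIMSEQ_inverse_real_of_nat)
  ultimately have pd: "(norm (z - p))\<^sup>2 \<le> d"
    using xd by (intro LIMSEQ_le[of _ _ _ d]) (auto intro: less_imp_le)
  show ?thesis
  proof (rule that)
    show "z - p \<noteq> 0" using z pM by auto
    fix v assume v: "v \<in> M"
    show "v \<bullet> (z - p) = 0"
    proof (cases "v = 0")
      case False
      \<comment> \<open>The coefficient minimising the distance from z to the line p + s v: unless v
        is orthogonal to z - p, it would beat the minimiser p.\<close>
      define s where "s = (v \<bullet> (z - p)) / (v \<bullet> v)"
      have "p + s *\<^sub>R v \<in> M" using sub pM v by (simp add: subspace_add subspace_scale)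
      then have "(norm (z - p))\<^sup>2 \<le> (norm (z - (p + s *\<^sub>R v)))\<^sup>2"
        by (rule order_trans[OF pd d_le])
      also have "\<dots> = (norm (z - p))\<^sup>2 - 2 * s * (v \<bullet> (z - p)) + s\<^sup>2 * (v \<bullet> v)"
        unfolding power2_norm_eq_inner
        by (simp add: algebra_simps inner_commute power2_eq_square)
      also have "\<dots> = (norm (z - p))\<^sup>2 - (v \<bullet> (z - p))\<^sup>2 / (v \<bullet> v)"
        using False by (simp add: s_def field_simps power2_eq_square)
      finally have "(v \<bullet> (z - p))\<^sup>2 / (v \<bullet> v) \<le> 0" by simp
      moreover have "0 < v \<bullet> v" using False by simp
      ultimately show ?thesis
        by (auto simp: divide_le_0_iff)
    qed simp
  qed
qed

text \<open>The kernel of a nonzero functional has codimension one, so a vector orthogonal to it,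
  suitably scaled, represents the functional.\<close>

lemma riesz_representation:
  fixes \<phi> :: "'a::{real_inner,complete_space} \<Rightarrow> real"
  assumes "bounded_linear \<phi>"
  obtains z where "\<And>x. \<phi> x = x \<bullet> z"
proof -
  interpret bounded_linear \<phi> by fact
  define M where "M = {x. \<phi> x = 0}"
  show ?thesis
  proof (cases "M = UNIV")
    case True
    then show ?thesis by (intro that[of 0]) (auto simp: M_def)
  next
    case False
    have "subspace M" by (auto simp: M_def subspace_def add scaleR zero)
    moreover have "closed M"
      unfolding M_def by (intro closed_Collect_eq continuous_on continuous_on_const continuous_on_id)
    ultimately obtain y where y: "y \<noteq> 0" "\<And>x. x \<in> M \<Longrightarrow> x \<bullet> y = 0"
      using False closed_subspace_orthogonal by blast
    have "\<phi> y \<noteq> 0" using y(1) y(2)[of y] by (auto simp: M_def)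
    have "\<phi> x = x \<bullet> ((\<phi> y / (y \<bullet> y)) *\<^sub>R y)" for x
    proof -
      have "x - (\<phi> x / \<phi> y) *\<^sub>R y \<in> M"
        using \<open>\<phi> y \<noteq> 0\<close> by (simp add: M_def diff scaleR)
      from y(2)[OF this] have "x \<bullet> y = (\<phi> x / \<phi> y) * (y \<bullet> y)"
        by (simp add: inner_diff_left)
      then show ?thesis using \<open>\<phi> y \<noteq> 0\<close> y(1) by simp
    qed
    then show ?thesis by (rule that)
  qed
qed

section \<open>Weak integration and differentiation of H-valued functions\<close>

lemma has_integral_Icc_diff:
  fixes f :: "real \<Rightarrow> 'a::banach"
  assumes I: "(f has_integral I) {c..a}" and J: "(f has_integral J) {c..b}" and "c \<le> a" "a \<le> b"
  shows "(f has_integral (J - I)) {a..b}"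
proof -
  have int: "f integrable_on {a..b}"
    by (rule integrable_on_subinterval[OF has_integral_integrable[OF J]]) (use assms(3) in auto)
  have "integral {c..a} f + integral {a..b} f = integral {c..b} f"
    by (rule Henstock_Kurzweil_Integration.integral_combine[OF assms(3,4) has_integral_integrable[OF J]])
  then have "integral {a..b} f = J - I"
    using integral_unique[OF I] integral_unique[OF J] by (simp add: algebra_simps)
  then show ?thesis using integrable_integral[OF int] by simp
qed

text \<open>A mean value estimate without a vector integral: testing the increment formula with the
  remainder itself turns a scalar integral bound into a bound on the norm of the remainder, which
  the continuity of \<open>g\<close> makes small.\<close>

lemma weak_integral_imp_vector_derivative:
  fixes g Y :: "real \<Rightarrow> 'a::real_inner"
  assumes g: "continuous_on {a..b} g"
    and Y: "\<And>v t. t \<in> {a..b} \<Longrightarrow> ((\<lambda>s. g s \<bullet> v) has_integral (Y t \<bullet> v - Y a \<bullet> v)) {a..t}"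
    and t: "t \<in> {a..b}"
  shows "(Y has_vector_derivative g t) (at t within {a..b})"
proof -
  have diff: "((\<lambda>s. g s \<bullet> v) has_integral (Y q \<bullet> v - Y p \<bullet> v)) {p..q}"
    if pq: "p \<in> {a..b}" "q \<in> {a..b}" "p \<le> q" for p q v
    using has_integral_Icc_diff[OF Y[OF pq(1)] Y[OF pq(2)] _ pq(3), of v] pq(1) by simp
  have key: "norm (Y q - Y p - (q - p) *\<^sub>R g t) \<le> e * \<bar>q - p\<bar>"
    if pq: "p \<in> {a..b}" "q \<in> {a..b}" "p \<le> q"
      and e: "\<And>s. s \<in> {p..q} \<Longrightarrow> norm (g s - g t) \<le> e" for p q e
  proof -
    define v where "v = Y q - Y p - (q - p) *\<^sub>R g t"
    have "((\<lambda>s. g s \<bullet> v - g t \<bullet> v) has_integral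
        (Y q \<bullet> v - Y p \<bullet> v - (q - p) *\<^sub>R (g t \<bullet> v))) {p..q}"
      using diff[OF pq, of v] has_integral_const_real[of "g t \<bullet> v" p q] pq
      by (intro has_integral_diff) auto
    then have "((\<lambda>s. (g s - g t) \<bullet> v) has_integral (v \<bullet> v)) {p..q}"
      by (simp add: v_def inner_diff_left)
    moreover have "((\<lambda>s. e * norm v) has_integral (q - p) *\<^sub>R (e * norm v)) {p..q}"
      using has_integral_const_real[of "e * norm v" p q] pq by auto
    ultimately have "v \<bullet> v \<le> (q - p) *\<^sub>R (e * norm v)"
    proof (rule has_integral_le)
      fix s assume "s \<in> {p..q}"
      then show "(g s - g t) \<bullet> v \<le> e * norm v"
        using norm_cauchy_schwarz[of "g s - g t" v] mult_right_mono[OF e[of s] norm_ge_zero[of v]]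
        by linarith
    qed
    then have "norm v * norm v \<le> (e * \<bar>q - p\<bar>) * norm v"
      using pq by (simp add: dot_square_norm power2_eq_square algebra_simps)
    moreover have "0 \<le> e" using order_trans[OF norm_ge_zero e[of p]] pq by simp
    ultimately have "norm v \<le> e * \<bar>q - p\<bar>"
      by (cases "v = 0") (auto simp: mult_le_cancel_right)
    then show ?thesis by (simp only: v_def)
  qed
  show ?thesis
    unfolding has_vector_derivative_def
  proof (subst has_derivative_within_alt, intro conjI allI impI)
    show "bounded_linear (\<lambda>x. x *\<^sub>R g t)" by (rule bounded_linear_scaleR_left)
    fix e :: real assume "0 < e"
    then obtain d where d: "0 < d" and gd: "\<And>s. s \<in> {a..b} \<Longrightarrow> dist s t < d \<Longrightarrow> dist (g s) (g t) < e"
      using g t unfolding continuous_on_iff by blast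
    show "\<exists>d>0. \<forall>y\<in>{a..b}. norm (y - t) < d \<longrightarrow>
        norm (Y y - Y t - (y - t) *\<^sub>R g t) \<le> e * norm (y - t)"
    proof (intro exI conjI ballI impI)
      show "0 < d" by fact
      fix y assume y: "y \<in> {a..b}" "norm (y - t) < d"
      have near: "norm (g s - g t) \<le> e" if "s \<in> {t..y} \<or> s \<in> {y..t}" for s
      proof -
        have "s \<in> {a..b}" "dist s t < d" using that y t by (auto simp: dist_norm)
        then show ?thesis using gd[of s] by (simp add: dist_norm)
      qed
      show "norm (Y y - Y t - (y - t) *\<^sub>R g t) \<le> e * norm (y - t)"
      proof (cases "t \<le> y")
        case True
        then show ?thesis using key[of t y e] near t y by simp
      next
        case False
        have "norm (Y t - Y y - (t - y) *\<^sub>R g t) \<le> e * \<bar>t - y\<bar>"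
          using key[of y t e] near t y False by simp
        moreover have "Y t - Y y - (t - y) *\<^sub>R g t = - (Y y - Y t - (y - t) *\<^sub>R g t)"
          by (simp add: algebra_simps)
        ultimately show ?thesis by (simp only: norm_minus_cancel) (simp add: abs_minus_commute)
      qed
    qed
  qed
qed

text \<open>The functional sending v to the integral of q s . v is bounded by the integral of |q|,
  so Riesz supplies the vector that plays the role of the integral of \<open>q\<close>.\<close>

lemma weak_integral_exists:
  fixes q :: "real \<Rightarrow> 'a::{real_inner,complete_space}"
  assumes q: "continuous_on {a..b} q"
  obtains z where "\<And>v. ((\<lambda>s. q s \<bullet> v) has_integral (z \<bullet> v)) {a..b}"
proof -
  have int: "(\<lambda>s. q s \<bullet> v) integrable_on {a..b}" for v
    by (intro integrable_continuous_real continuous_intros q)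
  have intn: "(\<lambda>s. norm (q s)) integrable_on {a..b}"
    by (intro integrable_continuous_real continuous_intros q)
  have "bounded_linear (\<lambda>v. integral {a..b} (\<lambda>s. q s \<bullet> v))"
  proof (rule bounded_linear_intro[where K = "integral {a..b} (\<lambda>s. norm (q s))"])
    fix v w r
    show "integral {a..b} (\<lambda>s. q s \<bullet> (v + w)) = integral {a..b} (\<lambda>s. q s \<bullet> v) + integral {a..b} (\<lambda>s. q s \<bullet> w)"
      using int by (simp add: inner_add_right integral_add)
    show "integral {a..b} (\<lambda>s. q s \<bullet> (r *\<^sub>R v)) = r *\<^sub>R integral {a..b} (\<lambda>s. q s \<bullet> v)"
      by simp
    have "norm (integral {a..b} (\<lambda>s. q s \<bullet> v)) \<le> integral {a..b} (\<lambda>s. norm (q s) * norm v)"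
      using int by (rule integral_norm_bound_integral)
        (auto intro!: integrable_on_mult_left intn simp: Cauchy_Schwarz_ineq2)
    then show "norm (integral {a..b} (\<lambda>s. q s \<bullet> v)) \<le> norm v * integral {a..b} (\<lambda>s. norm (q s))"
      by (simp add: mult.commute)
  qed
  then obtain z where z: "\<And>v. integral {a..b} (\<lambda>s. q s \<bullet> v) = v \<bullet> z"
    using riesz_representation by blast
  show ?thesis
  proof (rule that[of z])
    show "((\<lambda>s. q s \<bullet> v) has_integral (z \<bullet> v)) {a..b}" for v
      using integrable_integral[OF int[of v]] z[of v] by (simp add: inner_commute)
  qed
qed

section \<open>Resolvents of skew-adjoint operators\<close>

text \<open>\<open>maximal\<close> says that the domain of the adjoint is contained in E. With
  \<open>skew\<close> this makes G skew-adjoint rather than merely skew-symmetric, and so makes the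
  resolvents surjective.\<close>

locale skew_adjoint =
  fixes E :: "'k::{real_inner,complete_space} set" and G :: "'k \<Rightarrow> 'k"
  assumes subspace_domain: "subspace E"
    and dense_domain: "closure E = UNIV"
    and G_add: "x \<in> E \<Longrightarrow> y \<in> E \<Longrightarrow> G (x + y) = G x + G y"
    and G_scale: "x \<in> E \<Longrightarrow> G (r *\<^sub>R x) = r *\<^sub>R G x"
    and skew: "x \<in> E \<Longrightarrow> y \<in> E \<Longrightarrow> G x \<bullet> y = - (x \<bullet> G y)"
    and maximal: "(\<And>x. x \<in> E \<Longrightarrow> G x \<bullet> y = x \<bullet> z) \<Longrightarrow> y \<in> E"
begin

lemma G_diff: "x \<in> E \<Longrightarrow> y \<in> E \<Longrightarrow> G (x - y) = G x - G y"
  using G_add[of x "(-1) *\<^sub>R y"] G_scale[of y "-1"] subspace_scale[OF subspace_domain, of y "-1"]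
  by simp

lemma skew_self: "x \<in> E \<Longrightarrow> G x \<bullet> x = 0"
  using skew[of x x] by (simp add: inner_commute)

lemma orthogonal_domain:
  assumes "\<And>x. x \<in> E \<Longrightarrow> x \<bullet> y = 0"
  shows "y = 0"
proof -
  have "closed {x. x \<bullet> y = 0}"
    by (intro closed_Collect_eq continuous_intros)
  then have "closure E \<subseteq> {x. x \<bullet> y = 0}"
    using assms by (intro closure_minimal) auto
  then have "y \<bullet> y = 0" using dense_domain by blast
  then show ?thesis by simp
qed

text \<open>Adjoints have closed graphs: the skew pairing with a fixed vector of E passes to the
  limit, \<open>maximal\<close> then admits the limit, and density identifies its image.\<close>

lemma graph_closed:
  assumes x: "\<And>n. x n \<in> E" and lim: "x \<longlonglongrightarrow> a" "(\<lambda>n. G (x n)) \<longlonglongrightarrow> b"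
  shows "a \<in> E" "G a = b"
proof -
  have *: "G y \<bullet> a = y \<bullet> (- b)" if "y \<in> E" for y
  proof (rule LIMSEQ_unique)
    show "(\<lambda>n. G y \<bullet> x n) \<longlonglongrightarrow> G y \<bullet> a" by (intro tendsto_intros lim)
    have "(\<lambda>n. - (y \<bullet> G (x n))) \<longlonglongrightarrow> - (y \<bullet> b)" by (intro tendsto_intros lim)
    then show "(\<lambda>n. G y \<bullet> x n) \<longlonglongrightarrow> y \<bullet> (- b)" using skew[OF that x] by simp
  qed
  then show a: "a \<in> E" by (rule maximal)
  have "G a - b = 0"
    using * skew[OF _ a] by (intro orthogonal_domain) (simp add: inner_diff_right)
  then show "G a = b" by simp
qed

text \<open>The cross term vanishes because G x is orthogonal to x. Injectivity, contractivity and
  closed range of I - \<epsilon> G all come from this identity, for either sign of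
  \<epsilon>.\<close>

lemma norm_resolvent_equation:
  assumes "x \<in> E"
  shows "(norm (x - \<epsilon> *\<^sub>R G x))\<^sup>2 = (norm x)\<^sup>2 + \<epsilon>\<^sup>2 * (norm (G x))\<^sup>2"
  unfolding power2_norm_eq_inner using skew_self[OF assms]
  by (simp add: inner_commute algebra_simps power2_eq_square)

text \<open>The range is closed, and a vector y orthogonal to it lies in E with G y = - y /
  \<epsilon>; pairing with y kills the left side, so y vanishes.\<close>

lemma resolvent_surj:
  assumes "\<epsilon> \<noteq> 0"
  shows "(\<lambda>x. x - \<epsilon> *\<^sub>R G x) ` E = UNIV"
proof (rule ccontr)
  let ?R = "(\<lambda>x. x - \<epsilon> *\<^sub>R G x) ` E"
  assume ne: "?R \<noteq> UNIV"
  have diff: "(x - \<epsilon> *\<^sub>R G x) - (y - \<epsilon> *\<^sub>R G y) = (x - y) - \<epsilon> *\<^sub>R G (x - y)" if "x \<in> E" "y \<in> E" for x y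
    using that by (simp add: G_diff algebra_simps)
  have sub: "subspace ?R"
    unfolding subspace_def
  proof (intro conjI ballI allI)
    have "0 \<in> E" using subspace_domain by (rule subspace_0)
    moreover from this have "G 0 = 0" using G_scale[of 0 0] by simp
    ultimately show "0 \<in> ?R" by (intro image_eqI[of _ _ 0]) auto
    fix y z assume "y \<in> ?R" "z \<in> ?R"
    then obtain a b where ab: "a \<in> E" "b \<in> E"
      and yz: "y = a - \<epsilon> *\<^sub>R G a" "z = b - \<epsilon> *\<^sub>R G b" by blast
    have "y + z = (a + b) - \<epsilon> *\<^sub>R G (a + b)"
      unfolding yz G_add[OF ab] by (simp add: algebra_simps)
    then show "y + z \<in> ?R"
      using subspace_add[OF subspace_domain ab] by blast
  next
    fix r y assume "y \<in> ?R"
    then obtain a where a: "a \<in> E" and y: "y = a - \<epsilon> *\<^sub>R G a" by blast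
    have "r *\<^sub>R y = r *\<^sub>R a - \<epsilon> *\<^sub>R G (r *\<^sub>R a)"
      unfolding y G_scale[OF a] by (simp add: algebra_simps)
    then show "r *\<^sub>R y \<in> ?R"
      using subspace_scale[OF subspace_domain a] by blast
  qed
  have "closed ?R"
    unfolding closed_sequential_limits
  proof (intro allI impI, elim conjE)
    fix y l assume yR: "\<forall>n. y n \<in> ?R" and l: "y \<longlonglongrightarrow> l"
    from yR have "\<forall>n. \<exists>x\<in>E. y n = x - \<epsilon> *\<^sub>R G x" by auto
    then obtain x where xE: "\<And>n. x n \<in> E" and y: "\<And>n. y n = x n - \<epsilon> *\<^sub>R G (x n)" by metis
    have "Cauchy x"
    proof (rule metric_CauchyI)
      fix e :: real assume "0 < e"
      then obtain N where N: "\<And>k l. k \<ge> N \<Longrightarrow> l \<ge> N \<Longrightarrow> dist (y k) (y l) < e"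
        using LIMSEQ_imp_Cauchy[OF l] unfolding Cauchy_def by blast
      have "dist (x k) (x l) \<le> dist (y k) (y l)" for k l
      proof -
        have "x k - x l \<in> E" using xE subspace_domain by (simp add: subspace_diff)
        from norm_resolvent_equation[OF this, of \<epsilon>]
        have "(norm (x k - x l))\<^sup>2 \<le> (norm (y k - y l))\<^sup>2"
          unfolding y diff[OF xE xE] by simp
        then show ?thesis by (simp add: dist_norm)
      qed
      then show "\<exists>N. \<forall>k\<ge>N. \<forall>l\<ge>N. dist (x k) (x l) < e"
        using N order_le_less_trans by blast
    qed
    then obtain a where a: "x \<longlonglongrightarrow> a" using Cauchy_convergent convergent_def by blast
    have "(\<lambda>n. (1 / \<epsilon>) *\<^sub>R (x n - y n)) \<longlonglongrightarrow> (1 / \<epsilon>) *\<^sub>R (a - l)" by (intro tendsto_intros a l)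
    moreover have "G (x n) = (1 / \<epsilon>) *\<^sub>R (x n - y n)" for n using assms by (simp add: y)
    ultimately have "(\<lambda>n. G (x n)) \<longlonglongrightarrow> (1 / \<epsilon>) *\<^sub>R (a - l)" by simp
    from graph_closed[OF xE a this] have "a \<in> E" "l = a - \<epsilon> *\<^sub>R G a" using assms by auto
    then show "l \<in> ?R" by blast
  qed
  then obtain y where y: "y \<noteq> 0" and yR: "\<And>z. z \<in> ?R \<Longrightarrow> z \<bullet> y = 0"
    using closed_subspace_orthogonal[OF sub _ ne] by metis
  have orth: "(x - \<epsilon> *\<^sub>R G x) \<bullet> y = 0" if "x \<in> E" for x
    using that by (intro yR imageI)
  have *: "G x \<bullet> y = x \<bullet> ((1 / \<epsilon>) *\<^sub>R y)" if "x \<in> E" for x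
    using orth[OF that] assms by (simp add: inner_diff_left field_simps)
  then have yE: "y \<in> E" by (rule maximal)
  have "G y + (1 / \<epsilon>) *\<^sub>R y = 0"
  proof (rule orthogonal_domain)
    fix x assume "x \<in> E"
    from *[OF this] skew[OF this yE] show "x \<bullet> (G y + (1 / \<epsilon>) *\<^sub>R y) = 0"
      by (simp add: inner_add_right)
  qed
  then have "G y = - ((1 / \<epsilon>) *\<^sub>R y)" by (simp add: eq_neg_iff_add_eq_0)
  then have "(1 / \<epsilon>) * (y \<bullet> y) = 0" using skew_self[OF yE] by simp
  then show False using y assms by simp
qed

text \<open>The resolvent (I - \<epsilon> G)^(-1), parametrised by a step so that it approaches the
  identity as \<epsilon> tends to 0. Negative \<epsilon> matters because the adjoint of
  \<open>res \<epsilon>\<close> is \<open>res (- \<epsilon>)\<close>.\<close>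

definition res :: "real \<Rightarrow> 'k \<Rightarrow> 'k" where
  "res \<epsilon> y = (THE x. x \<in> E \<and> x - \<epsilon> *\<^sub>R G x = y)"

lemma resolvent_equation_inj:
  assumes "x \<in> E" "y \<in> E" "x - \<epsilon> *\<^sub>R G x = y - \<epsilon> *\<^sub>R G y"
  shows "x = y"
proof -
  have E: "x - y \<in> E" using assms subspace_domain by (simp add: subspace_diff)
  have "(x - y) - \<epsilon> *\<^sub>R G (x - y) = 0" using assms by (simp add: G_diff algebra_simps)
  then have "(norm (x - y))\<^sup>2 + \<epsilon>\<^sup>2 * (norm (G (x - y)))\<^sup>2 = 0"
    using norm_resolvent_equation[OF E, of \<epsilon>] by simp
  then have "(norm (x - y))\<^sup>2 \<le> 0"
    by (metis add_nonneg_eq_0_iff order_refl zero_le_mult_iff zero_le_power2)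
  then show ?thesis by simp
qed

context
  fixes \<epsilon> :: real
  assumes \<epsilon>: "\<epsilon> \<noteq> 0"
begin

lemma res_props: "res \<epsilon> y \<in> E \<and> res \<epsilon> y - \<epsilon> *\<^sub>R G (res \<epsilon> y) = y"
  unfolding res_def
proof (rule theI')
  have "y \<in> (\<lambda>x. x - \<epsilon> *\<^sub>R G x) ` E" using resolvent_surj[OF \<epsilon>] by simp
  then show "\<exists>!x. x \<in> E \<and> x - \<epsilon> *\<^sub>R G x = y" using resolvent_equation_inj by blast
qed

lemma res_in: "res \<epsilon> y \<in> E" and res_eq: "res \<epsilon> y - \<epsilon> *\<^sub>R G (res \<epsilon> y) = y"
  using res_props by blast+

lemma res_unique: "x \<in> E \<Longrightarrow> x - \<epsilon> *\<^sub>R G x = y \<Longrightarrow> res \<epsilon> y = x"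
  using resolvent_equation_inj[of "res \<epsilon> y" x \<epsilon>] res_props by auto

lemma G_res: "G (res \<epsilon> y) = (1 / \<epsilon>) *\<^sub>R (res \<epsilon> y - y)"
proof -
  have "res \<epsilon> y - y = \<epsilon> *\<^sub>R G (res \<epsilon> y)" using res_eq[of y] by (simp add: algebra_simps)
  then show ?thesis using \<epsilon> by simp
qed

lemma res_norm_le: "norm (res \<epsilon> y) \<le> norm y"
proof -
  have "(norm (res \<epsilon> y))\<^sup>2 \<le> (norm y)\<^sup>2"
    using norm_resolvent_equation[OF res_in, of y \<epsilon>] res_eq[of y] by simp
  then show ?thesis by simp
qed

lemma res_linear: "linear (res \<epsilon>)"
proof (rule linearI)
  fix x y r
  show "res \<epsilon> (x + y) = res \<epsilon> x + res \<epsilon> y"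
  proof (rule res_unique)
    show "res \<epsilon> x + res \<epsilon> y \<in> E" using subspace_domain res_in by (simp add: subspace_add)
    have "res \<epsilon> x + res \<epsilon> y - \<epsilon> *\<^sub>R G (res \<epsilon> x + res \<epsilon> y)
        = (res \<epsilon> x - \<epsilon> *\<^sub>R G (res \<epsilon> x)) + (res \<epsilon> y - \<epsilon> *\<^sub>R G (res \<epsilon> y))"
      by (simp only: G_add[OF res_in res_in]) (simp add: algebra_simps)
    then show "res \<epsilon> x + res \<epsilon> y - \<epsilon> *\<^sub>R G (res \<epsilon> x + res \<epsilon> y) = x + y" by (simp only: res_eq)
  qed
  show "res \<epsilon> (r *\<^sub>R x) = r *\<^sub>R res \<epsilon> x"
  proof (rule res_unique)
    show "r *\<^sub>R res \<epsilon> x \<in> E" using subspace_domain res_in by (simp add: subspace_scale)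
    have "r *\<^sub>R res \<epsilon> x - \<epsilon> *\<^sub>R G (r *\<^sub>R res \<epsilon> x) = r *\<^sub>R (res \<epsilon> x - \<epsilon> *\<^sub>R G (res \<epsilon> x))"
      by (simp only: G_scale[OF res_in]) (simp add: algebra_simps)
    then show "r *\<^sub>R res \<epsilon> x - \<epsilon> *\<^sub>R G (r *\<^sub>R res \<epsilon> x) = r *\<^sub>R x" by (simp only: res_eq)
  qed
qed

lemma res_bounded_linear: "bounded_linear (res \<epsilon>)"
  using linear_add[OF res_linear] linear_scale[OF res_linear] res_norm_le
  by (intro bounded_linear_intro[where K = 1]) simp_all

text \<open>On E, x is itself the resolvent of x - \<epsilon> G x, so the error is \<epsilon> times
  the resolvent of G x, and contractivity finishes.\<close>

lemma res_dist_domain: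
  assumes "x \<in> E"
  shows "norm (res \<epsilon> x - x) \<le> \<bar>\<epsilon>\<bar> * norm (G x)"
proof -
  interpret R: bounded_linear "res \<epsilon>" by (rule res_bounded_linear)
  have "x - res \<epsilon> x = res \<epsilon> (x - \<epsilon> *\<^sub>R G x) - res \<epsilon> x"
    using res_unique[OF assms refl] by simp
  also have "\<dots> = - (\<epsilon> *\<^sub>R res \<epsilon> (G x))" by (simp add: R.diff R.scaleR)
  finally have "norm (res \<epsilon> x - x) = \<bar>\<epsilon>\<bar> * norm (res \<epsilon> (G x))"
    by (metis norm_minus_cancel norm_minus_commute norm_scaleR)
  then show ?thesis by (simp add: mult_left_mono res_norm_le)
qed

end

lemma res_adjoint:
  assumes "\<epsilon> \<noteq> 0"
  shows "res \<epsilon> x \<bullet> y = x \<bullet> res (- \<epsilon>) y"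
proof -
  define a b where "a = res \<epsilon> x" and "b = res (- \<epsilon>) y"
  have "a \<in> E" "b \<in> E" and x: "x = a - \<epsilon> *\<^sub>R G a" and y: "y = b + \<epsilon> *\<^sub>R G b"
    using res_in[of \<epsilon>] res_in[of "- \<epsilon>"] res_eq[of \<epsilon> x] res_eq[of "- \<epsilon>" y] assms
    by (simp_all add: a_def b_def)
  have "a \<bullet> y = x \<bullet> b"
    unfolding x y using skew[OF \<open>a \<in> E\<close> \<open>b \<in> E\<close>] by (simp add: algebra_simps)
  then show ?thesis by (simp add: a_def b_def)
qed

text \<open>On E the convergence has the rate |\<epsilon>| |G y|; the contraction bound is uniform
  in \<epsilon> and carries it over to the closure.\<close>

lemma res_tendsto:
  assumes ne: "\<And>n. \<epsilon> n \<noteq> 0" and lim: "\<epsilon> \<longlonglongrightarrow> 0"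
  shows "(\<lambda>n. res (\<epsilon> n) x) \<longlonglongrightarrow> x"
proof (rule LIMSEQ_I)
  fix e :: real assume "0 < e"
  then have "0 < e / 3" by simp
  moreover have "x \<in> closure E" by (simp add: dense_domain)
  ultimately obtain y where y: "y \<in> E" "dist y x < e / 3"
    by (meson closure_approachable)
  have "(\<lambda>n. \<bar>\<epsilon> n\<bar> * norm (G y)) \<longlonglongrightarrow> \<bar>0\<bar> * norm (G y)" by (intro tendsto_intros lim)
  then have "\<forall>\<^sub>F n in sequentially. \<bar>\<epsilon> n\<bar> * norm (G y) < e / 3"
    using \<open>0 < e / 3\<close> by (intro order_tendstoD(2)[of _ 0]) auto
  then obtain N where N: "\<And>n. n \<ge> N \<Longrightarrow> \<bar>\<epsilon> n\<bar> * norm (G y) < e / 3"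
    unfolding eventually_sequentially by blast
  show "\<exists>N. \<forall>n\<ge>N. norm (res (\<epsilon> n) x - x) < e"
  proof (intro exI allI impI)
    fix n assume "N \<le> n"
    interpret R: bounded_linear "res (\<epsilon> n)" by (rule res_bounded_linear[OF ne])
    have "res (\<epsilon> n) x - x = res (\<epsilon> n) (x - y) + (res (\<epsilon> n) y - y) + (y - x)" by (simp add: R.diff)
    then have "norm (res (\<epsilon> n) x - x) \<le> norm (res (\<epsilon> n) (x - y)) + norm (res (\<epsilon> n) y - y) + norm (y - x)"
      by (metis norm_triangle_le norm_triangle_ineq add_right_mono)
    moreover have "norm (res (\<epsilon> n) (x - y)) \<le> norm (y - x)"
      using res_norm_le[OF ne, of n "x - y"] by (simp add: norm_minus_commute)
    moreover have "norm (res (\<epsilon> n) y - y) < e / 3"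
      using res_dist_domain[OF ne y(1), of n] N[OF \<open>N \<le> n\<close>] by linarith
    ultimately show "norm (res (\<epsilon> n) x - x) < e" using y(2) by (simp add: dist_norm)
  qed
qed

end

section \<open>Flows of bounded operators\<close>

lemma at_within_atLeast_Icc:
  fixes t :: real
  assumes "0 \<le> t" "t < R"
  shows "at t within {0..} = at t within {0..R}"
  using assms by (intro at_within_nhd[of t "{..<R}"]) auto

text \<open>The pointwise limit does not depend on R, so one function serves all bounded intervals;
  continuity at t is checked on an interval reaching beyond t.\<close>

lemma locally_uniform_limit:
  fixes f :: "nat \<Rightarrow> real \<Rightarrow> 'a::complete_space"
  assumes cont: "\<And>n. continuous_on {0..} (f n)"
    and cauchy: "\<And>R. uniformly_Cauchy_on {0..R} f"
  obtains g where "continuous_on {0..} g" "\<And>R. uniform_limit {0..R} f g sequentially"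
proof -
  define g where "g = (\<lambda>t. lim (\<lambda>n. f n t))"
  have lim: "uniform_limit {0..R} f g sequentially" for R
    using Cauchy_uniformly_convergent[OF cauchy[of R]]
    by (simp add: uniformly_convergent_uniform_limit_iff g_def)
  have contR: "continuous_on {0..R} g" for R
    by (rule uniform_limit_theorem[OF _ lim])
      (auto intro!: always_eventually continuous_on_subset[OF cont])
  have "continuous_on {0..} g"
    unfolding continuous_on_eq_continuous_within
  proof
    fix t :: real assume t: "t \<in> {0..}"
    then have "continuous (at t within {0..t + 1}) g"
      using contR[of "t + 1"] by (simp add: continuous_on_eq_continuous_within)
    then show "continuous (at t within {0..}) g"
      using t at_within_atLeast_Icc[of t "t + 1"] by simp
  qed
  then show ?thesis using lim by (rule that)
qed

lemma uniform_limit_has_integral: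
  fixes h :: "nat \<Rightarrow> real \<Rightarrow> real"
  assumes lim: "uniform_limit {a..b} h g sequentially"
    and cont: "\<And>n. continuous_on {a..b} (h n)"
    and int: "\<And>n. (h n has_integral I n) {a..b}" and I: "I \<longlonglongrightarrow> J"
  shows "(g has_integral J) {a..b}"
proof -
  obtain I' J' where "\<And>n. (h n has_integral I' n) {a..b}" "(g has_integral J') {a..b}" "I' \<longlonglongrightarrow> J'"
    using uniform_limit_integral[OF lim cont] by auto
  moreover from this(1) int have "I' = I" by (blast intro: has_integral_unique)
  ultimately show ?thesis using I LIMSEQ_unique by blast
qed

lemma norm_square_has_vector_derivative:
  assumes "(f has_vector_derivative f') (at t within S)"
  shows "((\<lambda>s. (norm (f s))\<^sup>2) has_vector_derivative (2 * (f' \<bullet> f t))) (at t within S)"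
  using bounded_bilinear.has_vector_derivative[OF bounded_bilinear_inner assms assms]
  by (simp add: power2_norm_eq_inner inner_commute)

text \<open>|f|^2 - 2 K t has nonpositive derivative. K = 0 gives the contraction property of the
  Yosida flows, small K their Cauchy estimate.\<close>

lemma norm_square_growth:
  fixes f g :: "real \<Rightarrow> 'a::real_inner"
  assumes cont: "continuous_on {0..} f"
    and der: "\<And>t. 0 \<le> t \<Longrightarrow> (f has_vector_derivative g t) (at t within {0..})"
    and le: "\<And>t. 0 \<le> t \<Longrightarrow> g t \<bullet> f t \<le> K"
    and t: "0 \<le> t"
  shows "(norm (f t))\<^sup>2 \<le> (norm (f 0))\<^sup>2 + 2 * K * t"
proof -
  have "(norm (f 0))\<^sup>2 - 2 * K * 0 \<ge> (norm (f t))\<^sup>2 - 2 * K * t"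
  proof (rule DERIV_nonpos_imp_decreasing_open[OF t])
    fix x :: real assume x: "0 < x" "x < t"
    then have "at x within {0..} = at x"
      by (intro at_within_open_subset[of x "{0<..}"]) auto
    with norm_square_has_vector_derivative[OF der[of x]] x
    have "((\<lambda>s. (norm (f s))\<^sup>2) has_real_derivative 2 * (g x \<bullet> f x)) (at x)"
      by (simp add: has_real_derivative_iff_has_vector_derivative)
    then have "((\<lambda>s. (norm (f s))\<^sup>2 - 2 * K * s) has_real_derivative 2 * (g x \<bullet> f x) - 2 * K) (at x)"
      by (rule DERIV_diff) (auto intro!: derivative_eq_intros)
    then show "\<exists>y. ((\<lambda>s. (norm (f s))\<^sup>2 - 2 * K * s) has_real_derivative y) (at x) \<and> y \<le> 0"
      using le[of x] x by (intro exI conjI) auto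
  next
    show "continuous_on {0..t} (\<lambda>s. (norm (f s))\<^sup>2 - 2 * K * s)"
      by (intro continuous_intros continuous_on_subset[OF cont]) auto
  qed
  then show ?thesis by simp
qed

text \<open>\<open>d\<close> stands for the iterates of an operator on a vector, tested against a
  fixed vector: differentiating the exponential series shifts the coefficients by one.\<close>

lemma exp_series_has_real_derivative:
  fixes d :: "nat \<Rightarrow> real"
  shows "((\<lambda>t. \<Sum>n<Suc N. t ^ n / fact n * d n) has_real_derivative (\<Sum>n<N. t ^ n / fact n * d (Suc n))) (at t within S)"
proof (induction N)
  case (Suc N)
  have "(real (Suc N) * t ^ N) / fact (Suc N) * d (Suc N) = t ^ N / fact N * d (Suc N)"
    by (simp del: of_nat_Suc)
  moreover have "((\<lambda>t. t ^ Suc N / fact (Suc N) * d (Suc N)) has_real_derivative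
      (real (Suc N) * t ^ N) / fact (Suc N) * d (Suc N)) (at t within S)"
    by (intro DERIV_cmult_right DERIV_cdivide) (use DERIV_pow[of "Suc N"] in simp)
  ultimately have "((\<lambda>t. t ^ Suc N / fact (Suc N) * d (Suc N)) has_real_derivative
      t ^ N / fact N * d (Suc N)) (at t within S)"
    by (simp only:)
  from DERIV_add[OF Suc.IH this] show ?case by (simp only: sum.lessThan_Suc)
qed auto

text \<open>The exponential series of t B applied to \<open>x\<close>. The limit is taken in the
  integrated equation tested against each v, and strong differentiability is recovered at the
  end.\<close>

lemma bounded_linear_flow:
  fixes B :: "'a::{real_inner,complete_space} \<Rightarrow> 'a"
  assumes "bounded_linear B"
  obtains f where "continuous_on {0..} f" "f 0 = x"
    "\<And>t. 0 \<le> t \<Longrightarrow> (f has_vector_derivative B (f t)) (at t within {0..})"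
proof -
  interpret bounded_linear B by fact
  obtain L where L: "0 \<le> L" "\<And>y. norm (B y) \<le> norm y * L" using nonneg_bounded by blast
  define c where "c n = (B ^^ n) x" for n
  define s where "s N t = (\<Sum>n<N. (t ^ n / fact n) *\<^sub>R c n)" for N and t :: real
  have B_s: "B (s N t) = (\<Sum>n<N. (t ^ n / fact n) *\<^sub>R c (Suc n))" for N t
    by (simp add: s_def sum scaleR c_def)
  have c_le: "norm (c n) \<le> L ^ n * norm x" for n
  proof (induction n)
    case (Suc n)
    have "norm (c (Suc n)) \<le> norm (c n) * L" using L(2) by (simp add: c_def)
    also have "\<dots> \<le> (L ^ n * norm x) * L" using Suc L(1) by (rule mult_right_mono)
    finally show ?case by (simp add: mult_ac)
  qed (simp add: c_def)
  have s_cont: "continuous_on S (s N)" for S N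
    unfolding s_def by (intro continuous_intros) auto
  have cauchy: "uniformly_Cauchy_on {0..R} s" for R
  proof (rule uniformly_Cauchy_onI')
    fix e :: real assume e: "0 < e"
    \<comment> \<open>Weierstrass majorant of the terms on the interval from 0 to R.\<close>
    let ?a = "\<lambda>n. inverse (fact n) * (\<bar>R\<bar> * L) ^ n * norm x"
    have "summable ?a" by (intro summable_mult2 summable_exp)
    then obtain M where M: "\<And>m n. m \<ge> M \<Longrightarrow> norm (sum ?a {m..<n}) < e"
      unfolding summable_Cauchy using e by blast
    show "\<exists>M. \<forall>t\<in>{0..R}. \<forall>m\<ge>M. \<forall>n>m. dist (s m t) (s n t) < e"
    proof (intro exI ballI allI impI)
      fix t m n assume t: "t \<in> {0..R}" and mn: "m \<ge> M" "n > m"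
      have "s n t - s m t = (\<Sum>k\<in>{m..<n}. (t ^ k / fact k) *\<^sub>R c k)"
        unfolding s_def using mn sum_diff_nat_ivl[of 0 m n]
        by (simp add: atLeast0LessThan)
      also have "norm \<dots> \<le> sum ?a {m..<n}"
      proof (rule sum_norm_le)
        fix k
        have "norm ((t ^ k / fact k) *\<^sub>R c k) \<le> (\<bar>R\<bar> ^ k / fact k) * (L ^ k * norm x)"
          unfolding norm_scaleR
          by (intro mult_mono c_le) (use t in \<open>auto intro!: divide_right_mono power_mono\<close>)
        then show "norm ((t ^ k / fact k) *\<^sub>R c k) \<le> ?a k"
          by (simp add: power_mult_distrib field_simps)
      qed
      also have "\<dots> < e" using M[OF mn(1), of n] by simp
      finally show "dist (s m t) (s n t) < e" by (simp add: dist_norm norm_minus_commute)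
    qed
  qed
  obtain f where f: "continuous_on {0..} f" and lim: "\<And>R. uniform_limit {0..R} s f sequentially"
    using locally_uniform_limit[of s, OF s_cont cauchy] by blast
  have pointwise: "(\<lambda>n. s n t) \<longlonglongrightarrow> f t" if "0 \<le> t" for t
    using tendsto_uniform_limitI[OF lim[of t]] that by auto
  \<comment> \<open>The empty sum \<open>s 0\<close> vanishes; from one term on, every partial sum
    starts at x. Hence the index shift in the limits below, which also matches the derivative of
    \<open>s (Suc n)\<close> with \<open>B (s n r)\<close>.\<close>
  have s0: "s (Suc N) 0 = x" for N
    by (induction N) (auto simp: s_def c_def)
  have f0: "f 0 = x"
  proof (rule LIMSEQ_unique)
    show "(\<lambda>n. s (Suc n) 0) \<longlonglongrightarrow> f 0" using pointwise[of 0] by (rule LIMSEQ_Suc) simp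
  qed (simp add: s0)
  have int: "((\<lambda>r. B (f r) \<bullet> v) has_integral (f t \<bullet> v - f 0 \<bullet> v)) {0..t}" if "0 \<le> t" for t v
  proof (rule uniform_limit_has_integral)
    show "uniform_limit {0..t} (\<lambda>n r. B (s n r) \<bullet> v) (\<lambda>r. B (f r) \<bullet> v) sequentially"
      by (intro bounded_linear.uniform_limit[OF bounded_linear_inner_left] uniform_limit lim)
    show "continuous_on {0..t} (\<lambda>r. B (s n r) \<bullet> v)" for n
      by (intro continuous_intros continuous_on s_cont)
    show "(\<lambda>n. s (Suc n) t \<bullet> v - s (Suc n) 0 \<bullet> v) \<longlonglongrightarrow> f t \<bullet> v - f 0 \<bullet> v"
      unfolding s0 f0 by (intro tendsto_intros LIMSEQ_Suc pointwise that)
    show "((\<lambda>r. B (s n r) \<bullet> v) has_integral s (Suc n) t \<bullet> v - s (Suc n) 0 \<bullet> v) {0..t}" for n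
    proof (rule fundamental_theorem_of_calculus[OF that])
      fix r assume "r \<in> {0..t}"
      show "((\<lambda>r. s (Suc n) r \<bullet> v) has_vector_derivative B (s n r) \<bullet> v) (at r within {0..t})"
        unfolding has_real_derivative_iff_has_vector_derivative[symmetric] B_s
        using exp_series_has_real_derivative[where N = n and d = "\<lambda>k. c k \<bullet> v" and t = r and S = "{0..t}"]
        by (simp only: s_def inner_sum_left inner_scaleR_left)
    qed
  qed
  show ?thesis
  proof (rule that[OF f f0])
    fix t :: real assume t: "0 \<le> t"
    have "(f has_vector_derivative B (f t)) (at t within {0..t + 1})"
    proof (rule weak_integral_imp_vector_derivative)
      show "continuous_on {0..t + 1} (\<lambda>r. B (f r))"
        by (intro continuous_on continuous_on_subset[OF f]) auto
    qed (use int t in auto)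
    then show "(f has_vector_derivative B (f t)) (at t within {0..})"
      using t at_within_atLeast_Icc[of t "t + 1"] by simp
  qed
qed

section \<open>Weak solutions of skew-adjoint evolution equations\<close>

context skew_adjoint
begin

text \<open>Formally X' = G X - F, and pairing with X cancels G X. Since X need not lie in E, this
  is done for the resolvent of X, and \<epsilon> then tends to 0 under the integral with |F| |X| as
  dominating function.\<close>

lemma energy_identity:
  fixes X F :: "real \<Rightarrow> 'k"
  assumes X: "continuous_on {a..b} X" and F: "continuous_on {a..b} F"
    and weak: "\<And>v t. v \<in> E \<Longrightarrow> t \<in> {a..b} \<Longrightarrow>
      ((\<lambda>s. X s \<bullet> G v + F s \<bullet> v) has_integral (X a \<bullet> v - X t \<bullet> v)) {a..t}"
    and t: "t \<in> {a..b}"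
  shows "((\<lambda>s. F s \<bullet> X s) has_integral ((norm (X a))\<^sup>2 - (norm (X t))\<^sup>2) / 2) {a..t}"
proof -
  have reg: "((\<lambda>s. res \<epsilon> (F s) \<bullet> res \<epsilon> (X s)) has_integral
      ((norm (res \<epsilon> (X a)))\<^sup>2 - (norm (res \<epsilon> (X t)))\<^sup>2) / 2) {a..t}" if \<epsilon>: "\<epsilon> \<noteq> 0" for \<epsilon>
  proof -
    interpret R: bounded_linear "res \<epsilon>" by (rule res_bounded_linear[OF \<epsilon>])
    define Y where "Y s = res \<epsilon> (X s)" for s
    define g where "g s = G (Y s) - res \<epsilon> (F s)" for s
    have g: "continuous_on {a..b} g"
      unfolding g_def Y_def G_res[OF \<epsilon>]
      by (intro continuous_intros R.continuous_on X F)
    have "((\<lambda>s. g s \<bullet> v) has_integral (Y r \<bullet> v - Y a \<bullet> v)) {a..r}" if r: "r \<in> {a..b}" for v r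
    proof -
      \<comment> \<open>Testing with the adjoint resolvent of an arbitrary v moves the smoothing
        onto X: the weak equation becomes Y' = G Y - \<open>res \<epsilon> (F s)\<close>, tested
        with v.\<close>
      let ?w = "res (- \<epsilon>) v"
      have w: "?w \<in> E" "?w + \<epsilon> *\<^sub>R G ?w = v"
        using res_in[of "- \<epsilon>" v] res_eq[of "- \<epsilon>" v] \<epsilon> by auto
      have XG: "X s \<bullet> G ?w = - (G (Y s) \<bullet> v)" for s
      proof -
        have Y: "Y s \<in> E" "Y s - \<epsilon> *\<^sub>R G (Y s) = X s"
          using res_in[OF \<epsilon>] res_eq[OF \<epsilon>] by (auto simp: Y_def)
        have "(Y s - \<epsilon> *\<^sub>R G (Y s)) \<bullet> G ?w = - (G (Y s) \<bullet> (?w + \<epsilon> *\<^sub>R G ?w))"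
          using skew[OF Y(1) w(1)] by (simp add: inner_diff_left inner_add_right)
        then show ?thesis by (simp only: Y w)
      qed
      have FX: "F s \<bullet> ?w = res \<epsilon> (F s) \<bullet> v" "X s \<bullet> ?w = Y s \<bullet> v" for s
        by (simp_all add: res_adjoint[OF \<epsilon>] Y_def)
      have "((\<lambda>s. - (X s \<bullet> G ?w + F s \<bullet> ?w)) has_integral - (X a \<bullet> ?w - X r \<bullet> ?w)) {a..r}"
        by (rule has_integral_neg[OF weak[OF w(1) r]])
      then show ?thesis unfolding XG FX by (simp add: g_def inner_diff_left)
    qed
    then have der: "(Y has_vector_derivative g s) (at s within {a..b})" if "s \<in> {a..b}" for s
      by (rule weak_integral_imp_vector_derivative[OF g _ that])
    have "((\<lambda>s. 2 * (g s \<bullet> Y s)) has_integral ((norm (Y t))\<^sup>2 - (norm (Y a))\<^sup>2)) {a..t}"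
    proof (rule fundamental_theorem_of_calculus)
      fix s assume "s \<in> {a..t}"
      then have "((\<lambda>s. (norm (Y s))\<^sup>2) has_vector_derivative 2 * (g s \<bullet> Y s)) (at s within {a..b})"
        using t by (intro norm_square_has_vector_derivative der) auto
      then show "((\<lambda>s. (norm (Y s))\<^sup>2) has_vector_derivative 2 * (g s \<bullet> Y s)) (at s within {a..t})"
        by (rule has_vector_derivative_within_subset) (use t in auto)
    qed (use t in auto)
    then have "((\<lambda>s. (- 1 / 2) * (2 * (g s \<bullet> Y s))) has_integral
        (- 1 / 2) * ((norm (Y t))\<^sup>2 - (norm (Y a))\<^sup>2)) {a..t}"
      by (rule has_integral_mult_right)
    moreover have "(- 1 / 2) * (2 * (g s \<bullet> Y s)) = res \<epsilon> (F s) \<bullet> res \<epsilon> (X s)" for s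
      using skew_self[OF res_in[OF \<epsilon>, of "X s"]] by (simp add: g_def Y_def inner_diff_left)
    moreover have "(- 1 / 2) * ((norm (Y t))\<^sup>2 - (norm (Y a))\<^sup>2)
        = ((norm (res \<epsilon> (X a)))\<^sup>2 - (norm (res \<epsilon> (X t)))\<^sup>2) / 2"
      by (simp add: Y_def right_diff_distrib diff_divide_distrib)
    ultimately show ?thesis by (simp only:)
  qed
  define \<epsilon> where "\<epsilon> n = inverse (real (Suc n))" for n
  have \<epsilon>: "\<epsilon> n \<noteq> 0" "\<epsilon> \<longlonglongrightarrow> 0" for n
    using LIMSEQ_inverse_real_of_nat by (auto simp: \<epsilon>_def[abs_def])
  note lim = res_tendsto[OF \<epsilon>]
  let ?h = "\<lambda>n s. res (\<epsilon> n) (F s) \<bullet> res (\<epsilon> n) (X s)"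
  have conts: "continuous_on {a..t} F" "continuous_on {a..t} X"
    using t by (auto intro: continuous_on_subset[OF F] continuous_on_subset[OF X])
  have int_lim: "(\<lambda>n. integral {a..t} (?h n)) \<longlonglongrightarrow> integral {a..t} (\<lambda>s. F s \<bullet> X s)"
  proof (rule dominated_convergence)
    show "?h n integrable_on {a..t}" for n using reg[OF \<epsilon>(1)] by blast
    show "(\<lambda>s. norm (F s) * norm (X s)) integrable_on {a..t}"
      by (intro integrable_continuous_real continuous_intros conts)
    show "norm (?h n s) \<le> norm (F s) * norm (X s)" for n s
      using Cauchy_Schwarz_ineq2[of "res (\<epsilon> n) (F s)" "res (\<epsilon> n) (X s)"]
        mult_mono[OF res_norm_le[OF \<epsilon>(1)[of n], of "F s"] res_norm_le[OF \<epsilon>(1)[of n], of "X s"]]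
      by simp
    show "(\<lambda>n. ?h n s) \<longlonglongrightarrow> F s \<bullet> X s" for s
      by (intro tendsto_intros lim)
  qed
  have int_eq: "integral {a..t} (?h n) = ((norm (res (\<epsilon> n) (X a)))\<^sup>2 - (norm (res (\<epsilon> n) (X t)))\<^sup>2) / 2" for n
    by (rule integral_unique[OF reg[OF \<epsilon>(1)]])
  have "(\<lambda>n. ((norm (res (\<epsilon> n) (X a)))\<^sup>2 - (norm (res (\<epsilon> n) (X t)))\<^sup>2) / 2) \<longlonglongrightarrow>
      ((norm (X a))\<^sup>2 - (norm (X t))\<^sup>2) / 2"
    by (intro tendsto_intros lim) simp
  with int_lim[unfolded int_eq]
  have "integral {a..t} (\<lambda>s. F s \<bullet> X s) = ((norm (X a))\<^sup>2 - (norm (X t))\<^sup>2) / 2"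
    by (rule LIMSEQ_unique)
  moreover have "(\<lambda>s. F s \<bullet> X s) integrable_on {a..t}"
    by (intro integrable_continuous_real continuous_intros conts)
  ultimately show ?thesis by (metis has_integral_integral)
qed

section \<open>Yosida approximations and the flow of a skew-adjoint operator\<close>

lemma yosida_bounded_linear:
  assumes "\<epsilon> \<noteq> 0"
  shows "bounded_linear (\<lambda>y. G (res \<epsilon> y))"
  unfolding G_res[OF assms]
  by (intro bounded_linear_const_scaleR bounded_linear_sub res_bounded_linear[OF assms] bounded_linear_ident)

text \<open>With r the resolvent of y, y = r - \<epsilon> G r and G r is orthogonal to r, which
  leaves - \<epsilon> |G r|^2.\<close>

lemma yosida_dissipative:
  assumes "0 < \<epsilon>"
  shows "G (res \<epsilon> y) \<bullet> y \<le> 0"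
proof -
  let ?r = "res \<epsilon> y"
  have \<epsilon>: "\<epsilon> \<noteq> 0" using assms by simp
  have "G ?r \<bullet> y = G ?r \<bullet> (?r - \<epsilon> *\<^sub>R G ?r)" by (simp only: res_eq[OF \<epsilon>])
  also have "\<dots> = - (\<epsilon> * (G ?r \<bullet> G ?r))"
    using skew_self[OF res_in[OF \<epsilon>, of y]] by (simp add: inner_diff_right)
  also have "\<dots> \<le> 0" using assms by simp
  finally show ?thesis .
qed

lemma yosida_flow_contraction:
  assumes "0 < \<epsilon>" and f: "continuous_on {0..} f"
    "\<And>t. 0 \<le> t \<Longrightarrow> (f has_vector_derivative G (res \<epsilon> (f t))) (at t within {0..})"
    and "0 \<le> t"
  shows "norm (f t) \<le> norm (f 0)"
  using norm_square_growth[OF f yosida_dissipative[OF assms(1)] assms(4)] by simp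

lemma yosida_bound_domain:
  assumes \<epsilon>: "0 < \<epsilon>" and "x \<in> E"
  shows "norm (G (res \<epsilon> x)) \<le> norm (G x)"
proof -
  have "\<epsilon> \<noteq> 0" using \<epsilon> by simp
  from res_dist_domain[OF this assms(2)] \<epsilon>
  show ?thesis by (simp add: G_res[OF \<open>\<epsilon> \<noteq> 0\<close>] pos_divide_le_eq mult.commute)
qed

text \<open>The difference of the two resolvent values is orthogonal to its image under G. What
  remains is the correction between a - b and that difference, of size (\<epsilon> + \<delta>) L,
  against a factor of size 2 L.\<close>

lemma yosida_difference:
  assumes \<epsilon>: "0 < \<epsilon>" "norm (G (res \<epsilon> a)) \<le> L" and \<delta>: "0 < \<delta>" "norm (G (res \<delta> b)) \<le> L"
  shows "(G (res \<epsilon> a) - G (res \<delta> b)) \<bullet> (a - b) \<le> 2 * (\<epsilon> + \<delta>) * L\<^sup>2"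
proof -
  have ne: "\<epsilon> \<noteq> 0" "\<delta> \<noteq> 0" using \<epsilon> \<delta> by auto
  define P Q where "P = G (res \<epsilon> a)" and "Q = G (res \<delta> b)"
  have E: "res \<epsilon> a \<in> E" "res \<delta> b \<in> E" using res_in ne by auto
  then have dE: "res \<epsilon> a - res \<delta> b \<in> E" using subspace_domain by (simp add: subspace_diff)
  have PQ: "(P - Q) \<bullet> (res \<epsilon> a - res \<delta> b) = 0"
    using skew_self[OF dE] by (simp add: G_diff[OF E] P_def Q_def)
  have "a - b = (res \<epsilon> a - \<epsilon> *\<^sub>R G (res \<epsilon> a)) - (res \<delta> b - \<delta> *\<^sub>R G (res \<delta> b))"
    by (simp only: res_eq[OF ne(1)] res_eq[OF ne(2)])
  also have "\<dots> = (res \<epsilon> a - res \<delta> b) - (\<epsilon> *\<^sub>R P - \<delta> *\<^sub>R Q)"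
    by (simp add: P_def Q_def algebra_simps)
  finally have "(P - Q) \<bullet> (a - b) = - ((P - Q) \<bullet> (\<epsilon> *\<^sub>R P - \<delta> *\<^sub>R Q))"
    using PQ by (simp add: inner_diff_right)
  also have "\<dots> \<le> norm (P - Q) * norm (\<epsilon> *\<^sub>R P - \<delta> *\<^sub>R Q)"
    using Cauchy_Schwarz_ineq2[of "P - Q" "\<epsilon> *\<^sub>R P - \<delta> *\<^sub>R Q"] by linarith
  also have "\<dots> \<le> (2 * L) * ((\<epsilon> + \<delta>) * L)"
  proof (rule mult_mono)
    show "norm (P - Q) \<le> 2 * L"
      using norm_triangle_ineq4[of P Q] \<epsilon>(2) \<delta>(2) by (simp add: P_def Q_def)
    have "norm (\<epsilon> *\<^sub>R P - \<delta> *\<^sub>R Q) \<le> \<epsilon> * norm P + \<delta> * norm Q"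
      using norm_triangle_ineq4[of "\<epsilon> *\<^sub>R P" "\<delta> *\<^sub>R Q"] \<epsilon> \<delta> by simp
    also have "\<dots> \<le> \<epsilon> * L + \<delta> * L"
      using \<epsilon> \<delta> by (intro add_mono mult_left_mono) (auto simp: P_def Q_def)
    finally show "norm (\<epsilon> *\<^sub>R P - \<delta> *\<^sub>R Q) \<le> (\<epsilon> + \<delta>) * L" by (simp add: algebra_simps)
    show "0 \<le> 2 * L" using order_trans[OF norm_ge_zero \<epsilon>(2)] by simp
  qed simp
  finally show ?thesis by (simp add: P_def Q_def power2_eq_square algebra_simps)
qed

text \<open>Yosida flows started at y in E are Cauchy at a rate set by |G y|; contractivity extends
  the convergence to every \<open>x\<close>, where the equation persists in the weak form with G
  moved onto v.\<close>

lemma weak_flow: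
  obtains f :: "real \<Rightarrow> 'k" where "continuous_on {0..} f" "f 0 = x"
    "\<And>v t. v \<in> E \<Longrightarrow> 0 \<le> t \<Longrightarrow> ((\<lambda>s. f s \<bullet> G v) has_integral (x \<bullet> v - f t \<bullet> v)) {0..t}"
proof -
  define \<epsilon> where "\<epsilon> n = inverse (real (Suc n))" for n
  have \<epsilon>: "0 < \<epsilon> n" "\<epsilon> n \<noteq> 0" "\<epsilon> \<longlonglongrightarrow> 0" for n
    using LIMSEQ_inverse_real_of_nat by (auto simp: \<epsilon>_def[abs_def])
  define B where "B n y = G (res (\<epsilon> n) y)" for n y
  have "\<forall>n y. \<exists>f. continuous_on {0..} f \<and> f 0 = y \<and>
      (\<forall>t\<ge>0. (f has_vector_derivative B n (f t)) (at t within {0..}))"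
    unfolding B_def using bounded_linear_flow[OF yosida_bounded_linear[OF \<epsilon>(2)]] by metis
  then obtain \<Phi> where cont: "\<And>n y. continuous_on {0..} (\<Phi> n y)" and init: "\<And>n y. \<Phi> n y 0 = y"
    and der: "\<And>n y t. 0 \<le> t \<Longrightarrow> (\<Phi> n y has_vector_derivative B n (\<Phi> n y t)) (at t within {0..})"
    by metis
  have lin: "bounded_linear (B n)" for n
    unfolding B_def[abs_def] by (rule yosida_bounded_linear[OF \<epsilon>(2)])
  have contr: "norm (\<Phi> n y t - \<Phi> n z t) \<le> norm (y - z)" if "0 \<le> t" for n y z t
  proof -
    have "norm (\<Phi> n y t - \<Phi> n z t) \<le> norm (\<Phi> n y 0 - \<Phi> n z 0)"
    proof (rule yosida_flow_contraction[OF \<epsilon>(1) _ _ that])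
      show "continuous_on {0..} (\<lambda>t. \<Phi> n y t - \<Phi> n z t)" by (intro continuous_intros cont)
      fix t :: real assume "0 \<le> t"
      then have "((\<lambda>t. \<Phi> n y t - \<Phi> n z t) has_vector_derivative B n (\<Phi> n y t) - B n (\<Phi> n z t)) (at t within {0..})"
        by (intro derivative_intros der)
      then show "((\<lambda>t. \<Phi> n y t - \<Phi> n z t) has_vector_derivative G (res (\<epsilon> n) (\<Phi> n y t - \<Phi> n z t))) (at t within {0..})"
        by (simp add: bounded_linear.linear[OF lin] linear_diff flip: B_def)
    qed
    then show ?thesis by (simp add: init)
  qed
  \<comment> \<open>\<open>B n\<close> commutes with its own flow, so its image of a trajectory is
    again a trajectory and does not grow.\<close>
  have B_le: "norm (B n (\<Phi> n y t)) \<le> norm (B n y)" if "0 \<le> t" for n y t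
  proof -
    have "norm (B n (\<Phi> n y t)) \<le> norm (B n (\<Phi> n y 0))"
    proof (rule yosida_flow_contraction[OF \<epsilon>(1) _ _ that])
      show "continuous_on {0..} (\<lambda>t. B n (\<Phi> n y t))"
        by (intro bounded_linear.continuous_on[OF lin] cont)
      show "((\<lambda>t. B n (\<Phi> n y t)) has_vector_derivative G (res (\<epsilon> n) (B n (\<Phi> n y t)))) (at t within {0..})"
        if "0 \<le> t" for t
        using bounded_linear.has_vector_derivative[OF lin der[OF that]] by (simp flip: B_def)
    qed
    then show ?thesis by (simp add: init)
  qed
  have dist_domain: "(norm (\<Phi> n y t - \<Phi> m y t))\<^sup>2 \<le> 4 * (\<epsilon> n + \<epsilon> m) * (norm (G y))\<^sup>2 * t"
    if y: "y \<in> E" and t: "0 \<le> t" for n m y t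
  proof -
    have L: "norm (B k (\<Phi> k y r)) \<le> norm (G y)" if "0 \<le> r" for k r
      using B_le[OF that, of k y] yosida_bound_domain[OF \<epsilon>(1)[of k] y] unfolding B_def by linarith
    have "(norm (\<Phi> n y t - \<Phi> m y t))\<^sup>2 \<le> (norm (\<Phi> n y 0 - \<Phi> m y 0))\<^sup>2 + 2 * (2 * (\<epsilon> n + \<epsilon> m) * (norm (G y))\<^sup>2) * t"
    proof (rule norm_square_growth[OF _ _ _ t])
      show "continuous_on {0..} (\<lambda>t. \<Phi> n y t - \<Phi> m y t)" by (intro continuous_intros cont)
      show "((\<lambda>t. \<Phi> n y t - \<Phi> m y t) has_vector_derivative B n (\<Phi> n y r) - B m (\<Phi> m y r)) (at r within {0..})"
        if "0 \<le> r" for r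
        using that by (intro derivative_intros der)
      show "(B n (\<Phi> n y r) - B m (\<Phi> m y r)) \<bullet> (\<Phi> n y r - \<Phi> m y r) \<le> 2 * (\<epsilon> n + \<epsilon> m) * (norm (G y))\<^sup>2"
        if "0 \<le> r" for r
        unfolding B_def
        by (intro yosida_difference \<epsilon>(1) L[OF that, unfolded B_def])
    qed
    then show ?thesis by (simp add: init algebra_simps)
  qed
  have cauchy: "uniformly_Cauchy_on {0..R} (\<lambda>n. \<Phi> n x)" for R
  proof (rule uniformly_Cauchy_onI)
    fix e :: real assume e: "0 < e"
    moreover have "x \<in> closure E" by (simp add: dense_domain)
    ultimately obtain y where y: "y \<in> E" "dist y x < e / 4"
      by (metis closure_approachable divide_pos_pos zero_less_numeral)
    \<comment> \<open>The 8 is the 4 of \<open>dist_domain\<close> times the two summands \<epsilon>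
      m and \<epsilon> n, each at most \<epsilon> M.\<close>
    have "(\<lambda>n. 8 * \<epsilon> n * (norm (G y))\<^sup>2 * \<bar>R\<bar>) \<longlonglongrightarrow> 8 * 0 * (norm (G y))\<^sup>2 * \<bar>R\<bar>"
      by (intro tendsto_intros \<epsilon>(3))
    then have "\<forall>\<^sub>F n in sequentially. 8 * \<epsilon> n * (norm (G y))\<^sup>2 * \<bar>R\<bar> < (e / 2)\<^sup>2"
      using e by (intro order_tendstoD(2)[of _ 0]) auto
    then obtain M where M: "8 * \<epsilon> M * (norm (G y))\<^sup>2 * \<bar>R\<bar> < (e / 2)\<^sup>2"
      unfolding eventually_sequentially by blast
    show "\<exists>M. \<forall>t\<in>{0..R}. \<forall>m\<ge>M. \<forall>n\<ge>M. dist (\<Phi> m x t) (\<Phi> n x t) < e"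
    proof (intro exI ballI allI impI)
      fix t m n assume t: "t \<in> {0..R}" and mn: "M \<le> m" "M \<le> n"
      then have t0: "0 \<le> t" by simp
      have "\<epsilon> m \<le> \<epsilon> M" "\<epsilon> n \<le> \<epsilon> M" using mn by (auto simp: \<epsilon>_def intro!: le_imp_inverse_le)
      then have "4 * (\<epsilon> m + \<epsilon> n) * (norm (G y))\<^sup>2 \<le> (8 * \<epsilon> M) * (norm (G y))\<^sup>2"
        by (intro mult_right_mono) auto
      then have "4 * (\<epsilon> m + \<epsilon> n) * (norm (G y))\<^sup>2 * t \<le> (8 * \<epsilon> M) * (norm (G y))\<^sup>2 * \<bar>R\<bar>"
        by (rule mult_mono) (use t \<epsilon>(1)[of M] in auto)
      with dist_domain[OF y(1) t0, of m n] M
      have "(norm (\<Phi> m y t - \<Phi> n y t))\<^sup>2 < (e / 2)\<^sup>2" by linarith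
      then have mid: "norm (\<Phi> m y t - \<Phi> n y t) < e / 2"
        by (rule power2_less_imp_less) (use e in simp)
      have ends: "norm (\<Phi> m x t - \<Phi> m y t) < e / 4" "norm (\<Phi> n y t - \<Phi> n x t) < e / 4"
        using contr[OF t0, of m x y] contr[OF t0, of n y x] y(2)
        by (simp_all add: dist_norm norm_minus_commute)
      have "\<Phi> m x t - \<Phi> n x t = (\<Phi> m x t - \<Phi> m y t) + (\<Phi> m y t - \<Phi> n y t) + (\<Phi> n y t - \<Phi> n x t)" by simp
      then have "norm (\<Phi> m x t - \<Phi> n x t)
          \<le> norm (\<Phi> m x t - \<Phi> m y t) + norm (\<Phi> m y t - \<Phi> n y t) + norm (\<Phi> n y t - \<Phi> n x t)"
        by (metis norm_triangle_le norm_triangle_ineq add_right_mono)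
      with mid ends show "dist (\<Phi> m x t) (\<Phi> n x t) < e" by (simp add: dist_norm)
    qed
  qed
  obtain f where f: "continuous_on {0..} f" and lim: "\<And>R. uniform_limit {0..R} (\<lambda>n. \<Phi> n x) f sequentially"
    using locally_uniform_limit[of "\<lambda>n. \<Phi> n x", OF cont cauchy] by blast
  have pointwise: "(\<lambda>n. \<Phi> n x t) \<longlonglongrightarrow> f t" if "0 \<le> t" for t
    using tendsto_uniform_limitI[OF lim[of t]] that by auto
  show ?thesis
  proof (rule that[OF f])
    show "f 0 = x"
      using pointwise[of 0] by (simp add: init LIMSEQ_const_iff)
    fix v and t :: real assume v: "v \<in> E" and t: "0 \<le> t"
    \<comment> \<open>In the Yosida equation G acts on the resolvent of the approximation. The two
      differ by \<epsilon> n times \<open>B n\<close> along the flow, which \<open>B_le\<close>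
      bounds by its initial size |res x - x|, uniformly in time.\<close>
    define r where "r n s = res (\<epsilon> n) (\<Phi> n x s)" for n s
    have r_eq: "r n s = \<Phi> n x s + \<epsilon> n *\<^sub>R B n (\<Phi> n x s)" for n s
      using res_eq[OF \<epsilon>(2), of n "\<Phi> n x s"] by (simp add: r_def B_def algebra_simps)
    have "uniform_limit {0..t} (\<lambda>n s. \<epsilon> n *\<^sub>R B n (\<Phi> n x s)) (\<lambda>s. 0) sequentially"
    proof (rule uniform_limit_null_comparison)
      have "norm (\<epsilon> n *\<^sub>R B n (\<Phi> n x s)) \<le> norm (res (\<epsilon> n) x - x)" if "s \<in> {0..t}" for n s
      proof -
        have "norm (\<epsilon> n *\<^sub>R B n (\<Phi> n x s)) \<le> \<epsilon> n * norm (B n x)"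
          using B_le[of s n x] that \<epsilon>(1)[of n] by (simp add: mult_left_mono)
        also have "\<dots> = norm (res (\<epsilon> n) x - x)"
          using \<epsilon>(1)[of n] by (simp add: B_def G_res[OF \<epsilon>(2)])
        finally show ?thesis .
      qed
      then show "\<forall>\<^sub>F n in sequentially. \<forall>s\<in>{0..t}. norm (\<epsilon> n *\<^sub>R B n (\<Phi> n x s)) \<le> norm (res (\<epsilon> n) x - x)"
        by simp
      have "(\<lambda>n. norm (res (\<epsilon> n) x - x)) \<longlonglongrightarrow> 0"
        using res_tendsto[OF \<epsilon>(2,3)] by (simp add: LIM_zero tendsto_norm_zero)
      then show "uniform_limit {0..t} (\<lambda>n s. norm (res (\<epsilon> n) x - x)) (\<lambda>_. 0) sequentially"
        unfolding uniform_limit_iff by (simp add: tendsto_iff)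
    qed
    from uniform_limit_add[OF lim this]
    have r_lim: "uniform_limit {0..t} r f sequentially"
      by (simp add: r_eq[abs_def])
    show "((\<lambda>s. f s \<bullet> G v) has_integral (x \<bullet> v - f t \<bullet> v)) {0..t}"
    proof (rule uniform_limit_has_integral)
      show "uniform_limit {0..t} (\<lambda>n s. r n s \<bullet> G v) (\<lambda>s. f s \<bullet> G v) sequentially"
        by (intro bounded_linear.uniform_limit[OF bounded_linear_inner_left] r_lim)
      show "continuous_on {0..t} (\<lambda>s. r n s \<bullet> G v)" for n
        unfolding r_def
        by (intro continuous_intros bounded_linear.continuous_on[OF res_bounded_linear[OF \<epsilon>(2)]]
            continuous_on_subset[OF cont]) auto
      show "(\<lambda>n. x \<bullet> v - \<Phi> n x t \<bullet> v) \<longlonglongrightarrow> x \<bullet> v - f t \<bullet> v"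
        by (intro tendsto_intros pointwise t)
      fix n
      have "((\<lambda>s. B n (\<Phi> n x s) \<bullet> v) has_integral (\<Phi> n x t \<bullet> v - \<Phi> n x 0 \<bullet> v)) {0..t}"
      proof (rule fundamental_theorem_of_calculus[OF t])
        fix s assume "s \<in> {0..t}"
        then have "(\<Phi> n x has_vector_derivative B n (\<Phi> n x s)) (at s within {0..t})"
          by (intro has_vector_derivative_within_subset[OF der]) auto
        then show "((\<lambda>s. \<Phi> n x s \<bullet> v) has_vector_derivative B n (\<Phi> n x s) \<bullet> v) (at s within {0..t})"
          by (rule bounded_linear.has_vector_derivative[OF bounded_linear_inner_left])
      qed
      from has_integral_neg[OF this]
      show "((\<lambda>s. r n s \<bullet> G v) has_integral (x \<bullet> v - \<Phi> n x t \<bullet> v)) {0..t}"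
        using skew[OF res_in[OF \<epsilon>(2)] v] by (simp add: B_def r_def init)
    qed
  qed
qed

end

section \<open>The wave equation\<close>

lemma self_adjoint_opD:
  assumes "self_adjoint_op D A"
  shows "subspace D" "closure D = UNIV"
    and "x \<in> D \<Longrightarrow> y \<in> D \<Longrightarrow> A (x + y) = A x + A y"
    and "x \<in> D \<Longrightarrow> A (r *\<^sub>R x) = r *\<^sub>R A x"
    and "x \<in> D \<Longrightarrow> y \<in> D \<Longrightarrow> A x \<bullet> y = x \<bullet> A y"
    and "(\<And>x. x \<in> D \<Longrightarrow> A x \<bullet> y = x \<bullet> z) \<Longrightarrow> y \<in> D"
  using assms unfolding self_adjoint_op_def by blast+

text \<open>The squared product norm of (S u, u') is twice the energy, so the abstract identity for
  |X|^2 becomes an energy identity.\<close>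

definition wave_gen :: "('h::real_inner \<Rightarrow> 'h) \<Rightarrow> 'h \<times> 'h \<Rightarrow> 'h \<times> 'h" where
  "wave_gen S v = (S (snd v), - S (fst v))"

context
  fixes DS :: "'h::{real_inner,complete_space} set" and S :: "'h \<Rightarrow> 'h"
  assumes sa: "self_adjoint_op DS S"
begin

lemma domain_zero: "0 \<in> DS" and self_adjoint_zero: "S 0 = 0"
  using subspace_0[OF self_adjoint_opD(1)[OF sa]] self_adjoint_opD(4)[OF sa, of 0 0] by auto

lemma self_adjoint_diff: "x \<in> DS \<Longrightarrow> y \<in> DS \<Longrightarrow> S (x - y) = S x - S y"
  using self_adjoint_opD(3)[OF sa, of x "(-1) *\<^sub>R y"] self_adjoint_opD(4)[OF sa, of y "-1"]
    subspace_scale[OF self_adjoint_opD(1)[OF sa], of y "-1"] by simp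

text \<open>For maximality, test vectors with one zero component split the adjoint relation into two
  relations for S.\<close>

lemma wave_skew_adjoint: "skew_adjoint (DS \<times> DS) (wave_gen S)"
proof
  show "subspace (DS \<times> DS)" using self_adjoint_opD(1)[OF sa] by (intro subspace_Times)
  show "closure (DS \<times> DS) = UNIV" using self_adjoint_opD(2)[OF sa] by (simp add: closure_Times)
  show "wave_gen S (x + y) = wave_gen S x + wave_gen S y" if "x \<in> DS \<times> DS" "y \<in> DS \<times> DS" for x y
    using that self_adjoint_opD(3)[OF sa] by (auto simp: wave_gen_def)
  show "wave_gen S (r *\<^sub>R x) = r *\<^sub>R wave_gen S x" if "x \<in> DS \<times> DS" for r x
    using that self_adjoint_opD(4)[OF sa] by (auto simp: wave_gen_def)
  show "wave_gen S x \<bullet> y = - (x \<bullet> wave_gen S y)" if "x \<in> DS \<times> DS" "y \<in> DS \<times> DS" for x y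
    using that self_adjoint_opD(5)[OF sa] by (auto simp: wave_gen_def inner_prod_def)
  show "y \<in> DS \<times> DS" if *: "\<And>x. x \<in> DS \<times> DS \<Longrightarrow> wave_gen S x \<bullet> y = x \<bullet> z" for y z
  proof -
    have "S x \<bullet> fst y = x \<bullet> snd z" if "x \<in> DS" for x
      using *[of "(0, x)"] that domain_zero by (simp add: wave_gen_def inner_prod_def self_adjoint_zero)
    then have "fst y \<in> DS" by (rule self_adjoint_opD(6)[OF sa])
    moreover have "S x \<bullet> snd y = x \<bullet> (- fst z)" if "x \<in> DS" for x
      using *[of "(x, 0)"] that domain_zero by (simp add: wave_gen_def inner_prod_def self_adjoint_zero)
    then have "snd y \<in> DS" by (rule self_adjoint_opD(6)[OF sa])
    ultimately show ?thesis by (simp add: mem_Times_iff)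
  qed
qed

text \<open>The flow yields only candidates p and q for S w and w'. The position is the weak
  integral of q started at \<open>w0\<close>; the first component of the flow equation is then the
  adjoint relation S v . w = v . p, so self-adjointness puts w into the domain and identifies S w
  with p.\<close>

lemma wave_weak_sol_exists:
  assumes w0: "w0 \<in> DS"
  obtains w w' where "wave_weak_sol DS S w w' w0 w1"
proof -
  interpret skew_adjoint "DS \<times> DS" "wave_gen S" by (rule wave_skew_adjoint)
  obtain f :: "real \<Rightarrow> 'h \<times> 'h" where f: "continuous_on {0..} f" and f0: "f 0 = (S w0, w1)"
    and weak: "\<And>v t. v \<in> DS \<times> DS \<Longrightarrow> 0 \<le> t \<Longrightarrow>
      ((\<lambda>s. f s \<bullet> wave_gen S v) has_integral ((S w0, w1) \<bullet> v - f t \<bullet> v)) {0..t}"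
    using weak_flow[of "(S w0, w1)"] by blast
  define p q where "p t = fst (f t)" and "q t = snd (f t)" for t
  have p: "continuous_on {0..} p" and q: "continuous_on {0..} q"
    unfolding p_def[abs_def] q_def[abs_def] by (intro continuous_intros f)+
  have p_weak: "((\<lambda>s. p s \<bullet> S v) has_integral (w1 \<bullet> v - q t \<bullet> v)) {0..t}" if "v \<in> DS" "0 \<le> t" for v t
    using weak[of "(0, v)" t] that domain_zero
    by (simp add: wave_gen_def inner_prod_def self_adjoint_zero p_def q_def)
  have q_weak: "((\<lambda>s. q s \<bullet> S v) has_integral (p t \<bullet> v - S w0 \<bullet> v)) {0..t}" if "v \<in> DS" "0 \<le> t" for v t
    using has_integral_neg[OF weak[of "(v, 0)" t]] that domain_zero
    by (simp add: wave_gen_def inner_prod_def self_adjoint_zero p_def q_def)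
  have "\<exists>z. \<forall>v. ((\<lambda>s. q s \<bullet> v) has_integral (z \<bullet> v)) {0..t}" for t
    by (rule weak_integral_exists[of 0 t q]) (auto intro: continuous_on_subset[OF q])
  then obtain z where z: "\<And>t v. ((\<lambda>s. q s \<bullet> v) has_integral (z t \<bullet> v)) {0..t}" by metis
  have "((\<lambda>s. q s \<bullet> z 0) has_integral (z 0 \<bullet> z 0)) {0}" using z[of "z 0" 0] by simp
  then have z0: "z 0 = 0" using has_integral_unique[OF _ has_integral_refl(2)] by fastforce
  define w where "w t = w0 + z t" for t
  have w_adj: "S v \<bullet> w t = v \<bullet> p t" if "v \<in> DS" "0 \<le> t" for v t
  proof -
    have "z t \<bullet> S v = p t \<bullet> v - S w0 \<bullet> v" using has_integral_unique[OF z q_weak[OF that]] .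
    moreover have "w0 \<bullet> S v = S w0 \<bullet> v" using self_adjoint_opD(5)[OF sa w0 that(1)] by simp
    ultimately show ?thesis by (simp add: w_def inner_add_right inner_commute)
  qed
  then have w_in: "w t \<in> DS" if "0 \<le> t" for t using that by (intro self_adjoint_opD(6)[OF sa]) blast
  have S_w: "S (w t) = p t" if "0 \<le> t" for t
  proof -
    \<comment> \<open>\<open>orthogonal_domain\<close> speaks of the product space, so the vector is
      embedded as a second component.\<close>
    have "(0, S (w t) - p t) = (0 :: 'h \<times> 'h)"
    proof (rule orthogonal_domain)
      fix x assume x: "x \<in> DS \<times> DS"
      then have "S (snd x) \<bullet> w t = snd x \<bullet> S (w t)"
        by (intro self_adjoint_opD(5)[OF sa] w_in that) auto
      then show "x \<bullet> (0, S (w t) - p t) = 0"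
        using w_adj[OF _ that, of "snd x"] x by (auto simp: inner_prod_def inner_diff_right)
    qed
    then show ?thesis by (simp add: zero_prod_def)
  qed
  have der: "(w has_vector_derivative q t) (at t within {0..})" if t: "0 \<le> t" for t
  proof -
    have "(w has_vector_derivative q t) (at t within {0..t + 1})"
    proof (rule weak_integral_imp_vector_derivative)
      show "continuous_on {0..t + 1} q" by (rule continuous_on_subset[OF q]) auto
      show "((\<lambda>s. q s \<bullet> v) has_integral w r \<bullet> v - w 0 \<bullet> v) {0..r}" for v r
        using z[of v r] by (simp add: w_def z0 inner_add_left)
    qed (use t in auto)
    then show ?thesis using t at_within_atLeast_Icc[of t "t + 1"] by simp
  qed
  have "continuous_on {0..} w"
    unfolding continuous_on_eq_continuous_within
    using has_vector_derivative_continuous[OF der] by auto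
  moreover have "continuous_on {0..} (\<lambda>t. S (w t))"
    using p by (rule continuous_on_eq) (simp add: S_w)
  moreover have "((\<lambda>s. S (w s) \<bullet> S v) has_integral (w1 \<bullet> v - q t \<bullet> v)) {0..t}" if "v \<in> DS" "0 \<le> t" for v t
    using p_weak[OF that] by (rule has_integral_eq[rotated]) (simp add: S_w)
  moreover have "q 0 = w1" by (simp add: q_def f0)
  ultimately have "wave_weak_sol DS S w q w0 w1"
    unfolding wave_weak_sol_def using w_in der q by (auto simp: w_def z0)
  then show ?thesis by (rule that)
qed

text \<open>The abstract identity for (S u, u') and the forcing (0, f). The hypothesis
  \<open>weak\<close> supplies the second component; the first is the derivative of u paired with S
  v, with S moved onto u.\<close>

lemma wave_energy_identity:
  fixes u u' f :: "real \<Rightarrow> 'h"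
  assumes u_in: "\<And>t. t \<in> {a..b} \<Longrightarrow> u t \<in> DS"
    and Su: "continuous_on {a..b} (\<lambda>t. S (u t))"
    and u_der: "\<And>t. t \<in> {a..b} \<Longrightarrow> (u has_vector_derivative u' t) (at t within {a..b})"
    and u': "continuous_on {a..b} u'" and f: "continuous_on {a..b} f"
    and weak: "\<And>v t. v \<in> DS \<Longrightarrow> t \<in> {a..b} \<Longrightarrow>
      ((\<lambda>s. S (u s) \<bullet> S v + f s \<bullet> v) has_integral (u' a \<bullet> v - u' t \<bullet> v)) {a..t}"
    and t: "t \<in> {a..b}"
  shows "((\<lambda>s. f s \<bullet> u' s) has_integral
    (((norm (S (u a)))\<^sup>2 + (norm (u' a))\<^sup>2) / 2 - ((norm (S (u t)))\<^sup>2 + (norm (u' t))\<^sup>2) / 2)) {a..t}"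
proof -
  interpret skew_adjoint "DS \<times> DS" "wave_gen S" by (rule wave_skew_adjoint)
  define X where "X s = (S (u s), u' s)" for s
  define F where "F s = (0 :: 'h, f s)" for s
  have "((\<lambda>s. F s \<bullet> X s) has_integral ((norm (X a))\<^sup>2 - (norm (X t))\<^sup>2) / 2) {a..t}"
  proof (rule energy_identity[OF _ _ _ t])
    show "continuous_on {a..b} X" unfolding X_def[abs_def] by (intro continuous_intros Su u')
    show "continuous_on {a..b} F" unfolding F_def[abs_def] by (intro continuous_intros f)
    fix v r assume v: "v \<in> DS \<times> DS" and r: "r \<in> {a..b}"
    then have v12: "fst v \<in> DS" "snd v \<in> DS" by auto
    have "((\<lambda>s. u' s \<bullet> S (fst v)) has_integral (u r \<bullet> S (fst v) - u a \<bullet> S (fst v))) {a..r}"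
    proof (rule fundamental_theorem_of_calculus)
      fix s assume "s \<in> {a..r}"
      then have "(u has_vector_derivative u' s) (at s within {a..r})"
        using r by (intro has_vector_derivative_within_subset[OF u_der]) auto
      then show "((\<lambda>s. u s \<bullet> S (fst v)) has_vector_derivative u' s \<bullet> S (fst v)) (at s within {a..r})"
        by (rule bounded_linear.has_vector_derivative[OF bounded_linear_inner_left])
    qed (use r in auto)
    moreover have "u s \<bullet> S (fst v) = S (u s) \<bullet> fst v" if "s \<in> {a..b}" for s
      using self_adjoint_opD(5)[OF sa u_in[OF that] v12(1)] by simp
    ultimately have "((\<lambda>s. u' s \<bullet> S (fst v)) has_integral (S (u r) \<bullet> fst v - S (u a) \<bullet> fst v)) {a..r}"
      using r by simp
    from has_integral_diff[OF weak[OF v12(2) r] this]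
    have "((\<lambda>s. S (u s) \<bullet> S (snd v) + f s \<bullet> snd v - u' s \<bullet> S (fst v)) has_integral
        (u' a \<bullet> snd v - u' r \<bullet> snd v - (S (u r) \<bullet> fst v - S (u a) \<bullet> fst v))) {a..r}" .
    then show "((\<lambda>s. X s \<bullet> wave_gen S v + F s \<bullet> v) has_integral X a \<bullet> v - X r \<bullet> v) {a..r}"
      by (simp add: X_def F_def wave_gen_def inner_prod_def algebra_simps)
  qed
  moreover have "(norm (X s))\<^sup>2 = (norm (S (u s)))\<^sup>2 + (norm (u' s))\<^sup>2" for s
    by (simp add: X_def power2_norm_eq_inner inner_prod_def)
  ultimately show ?thesis by (simp add: X_def F_def inner_prod_def diff_divide_distrib)
qed

text \<open>At a maximum N of |u'| the energy identity with zero data gives N^2 / 2 \<le> N times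
  the integral of |f|. Dividing by N takes the place of a Gronwall argument, so no exponential
  enters \<open>chat\<close>.\<close>

lemma wave_velocity_bound:
  fixes u u' f :: "real \<Rightarrow> 'h"
  assumes u_in: "\<And>t. t \<in> {a..b} \<Longrightarrow> u t \<in> DS"
    and Su: "continuous_on {a..b} (\<lambda>t. S (u t))"
    and u_der: "\<And>t. t \<in> {a..b} \<Longrightarrow> (u has_vector_derivative u' t) (at t within {a..b})"
    and u': "continuous_on {a..b} u'" and f: "continuous_on {a..b} f"
    and weak: "\<And>v t. v \<in> DS \<Longrightarrow> t \<in> {a..b} \<Longrightarrow>
      ((\<lambda>s. S (u s) \<bullet> S v + f s \<bullet> v) has_integral (u' a \<bullet> v - u' t \<bullet> v)) {a..t}"
    and init: "u a = 0" "u' a = 0" and ab: "a \<le> b"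
  shows "norm (u' b) \<le> 2 * integral {a..b} (\<lambda>s. norm (f s))"
proof -
  have intf: "(\<lambda>s. norm (f s)) integrable_on {a..b}"
    by (intro integrable_continuous_real continuous_intros f)
  obtain r where r: "r \<in> {a..b}" and max: "\<And>s. s \<in> {a..b} \<Longrightarrow> norm (u' s) \<le> norm (u' r)"
    using continuous_attains_sup[OF compact_Icc _ continuous_on_norm[OF u']] ab
    by (metis atLeastatMost_empty_iff2 not_le)
  let ?N = "norm (u' r)"
  have en: "((\<lambda>s. f s \<bullet> u' s) has_integral
      (((norm (S (u a)))\<^sup>2 + (norm (u' a))\<^sup>2) / 2 - ((norm (S (u r)))\<^sup>2 + (norm (u' r))\<^sup>2) / 2)) {a..r}"
    by (rule wave_energy_identity[OF u_in Su u_der u' f weak r])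
  have sub: "{a..r} \<subseteq> {a..b}" using r by auto
  have "((norm (S (u r)))\<^sup>2 + ?N\<^sup>2) / 2 \<le> integral {a..r} (\<lambda>s. ?N * norm (f s))"
  proof (rule has_integral_le)
    show "((\<lambda>s. - (f s \<bullet> u' s)) has_integral ((norm (S (u r)))\<^sup>2 + ?N\<^sup>2) / 2) {a..r}"
      using has_integral_neg[OF en] by (simp add: init self_adjoint_zero)
    show "((\<lambda>s. ?N * norm (f s)) has_integral integral {a..r} (\<lambda>s. ?N * norm (f s))) {a..r}"
      by (intro integrable_integral integrable_on_mult_right integrable_on_subinterval[OF intf sub])
    fix s assume s: "s \<in> {a..r}"
    have "- (f s \<bullet> u' s) \<le> norm (f s) * norm (u' s)"
      using Cauchy_Schwarz_ineq2[of "f s" "u' s"] by linarith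
    also have "\<dots> \<le> norm (f s) * ?N" using max[of s] s sub by (intro mult_left_mono) auto
    finally show "- (f s \<bullet> u' s) \<le> ?N * norm (f s)" by (simp add: mult.commute)
  qed
  also have "\<dots> = ?N * integral {a..r} (\<lambda>s. norm (f s))" by simp
  also have "\<dots> \<le> ?N * integral {a..b} (\<lambda>s. norm (f s))"
    by (intro mult_left_mono integral_subset_le sub intf integrable_on_subinterval[OF intf sub]) auto
  finally have "?N\<^sup>2 \<le> 2 * (?N * integral {a..b} (\<lambda>s. norm (f s)))"
    using zero_le_power2[of "norm (S (u r))"] unfolding add_divide_distrib by linarith
  then have "?N * ?N \<le> ?N * (2 * integral {a..b} (\<lambda>s. norm (f s)))"
    by (simp add: power2_eq_square mult_ac)
  moreover have "0 \<le> integral {a..b} (\<lambda>s. norm (f s))" by (intro integral_nonneg intf) auto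
  ultimately have "?N \<le> 2 * integral {a..b} (\<lambda>s. norm (f s))"
    by (cases "?N = 0") (auto simp: mult_le_cancel_left)
  then show ?thesis using max[of b] ab by auto
qed

end

section \<open>Energy estimates on a single interval\<close>

text \<open>Carries estimates over to the switching times, where the feedback may jump.\<close>

lemma continuous_le_at_right_end:
  fixes \<phi> :: "real \<Rightarrow> real"
  assumes "continuous_on {a..b} \<phi>" "a < b" "\<And>t. t \<in> {a..<b} \<Longrightarrow> \<phi> t \<le> K"
  shows "\<phi> b \<le> K"
proof (rule continuous_le_on_closure[of "{a..<b}" \<phi>])
  show "continuous_on (closure {a..<b}) \<phi>" "b \<in> closure {a..<b}"
    using assms(1,2) by simp_all
qed (rule assms(3))

text \<open>Cauchy-Schwarz against the constant 1, from the nonnegative integral of (g - k)^2 at the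
  mean value k.\<close>

lemma integral_square_le:
  fixes g :: "real \<Rightarrow> real"
  assumes g: "continuous_on {a..b} g" and ab: "a \<le> b"
  shows "(integral {a..b} g)\<^sup>2 \<le> (b - a) * integral {a..b} (\<lambda>s. (g s)\<^sup>2)"
proof (cases "a = b")
  case False
  define J where "J = integral {a..b} g"
  define I where "I = integral {a..b} (\<lambda>s. (g s)\<^sup>2)"
  define k where "k = J / (b - a)"
  have L: "0 < b - a" using ab False by simp
  have 1: "((\<lambda>s. (g s)\<^sup>2) has_integral I) {a..b}"
    unfolding I_def by (intro integrable_integral integrable_continuous_real continuous_intros g)
  have 2: "(g has_integral J) {a..b}"
    unfolding J_def by (intro integrable_integral integrable_continuous_real g)
  have 3: "((\<lambda>s. k\<^sup>2) has_integral (b - a) * k\<^sup>2) {a..b}"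
    using has_integral_const_real[of "k\<^sup>2" a b] ab by simp
  have "((\<lambda>s. (g s)\<^sup>2 - 2 * k * g s + k\<^sup>2) has_integral I - 2 * k * J + (b - a) * k\<^sup>2) {a..b}"
    by (intro has_integral_add has_integral_diff has_integral_mult_right 1 2 3)
  then have "0 \<le> I - 2 * k * J + (b - a) * k\<^sup>2"
  proof (rule has_integral_nonneg)
    show "0 \<le> (g s)\<^sup>2 - 2 * k * g s + k\<^sup>2" for s
      using zero_le_power2[of "g s - k"] by (simp add: power2_diff algebra_simps)
  qed
  also have "\<dots> = I - J\<^sup>2 / (b - a)"
  proof -
    have e1: "2 * k * J = 2 * (J\<^sup>2 / (b - a))" by (simp add: k_def power2_eq_square)
    have e2: "(b - a) * k\<^sup>2 = J\<^sup>2 / (b - a)" using L by (simp add: k_def power2_eq_square)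
    show ?thesis unfolding e1 e2 by simp
  qed
  finally have "J\<^sup>2 / (b - a) \<le> I" by simp
  then have "J\<^sup>2 \<le> I * (b - a)"
    using L by (simp only: pos_divide_le_eq)
  also have "\<dots> = (b - a) * I" by (rule mult.commute)
  finally show ?thesis by (simp only: J_def I_def)
qed simp

text \<open>\<open>f\<close> is the feedback along u. The observation time \<open>R\<close> may be
  shorter than the interval, so that one constant \<open>c\<close> serves intervals of different
  lengths.\<close>

lemma damped_interval:
  fixes u u' f :: "real \<Rightarrow> 'h::{real_inner,complete_space}" and \<iota> :: "'h \<Rightarrow> 'w::real_inner"
  assumes sa: "self_adjoint_op DS S" and ab: "a < b"
    and u_in: "\<And>t. t \<in> {a..b} \<Longrightarrow> u t \<in> DS"
    and Su: "continuous_on {a..b} (\<lambda>t. S (u t))"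
    and u_der: "\<And>t. t \<in> {a..b} \<Longrightarrow> (u has_vector_derivative u' t) (at t within {a..b})"
    and u': "continuous_on {a..b} u'" and f: "continuous_on {a..<b} f"
    and weak: "\<And>v t. v \<in> DS \<Longrightarrow> t \<in> {a..<b} \<Longrightarrow>
      ((\<lambda>s. S (u s) \<bullet> S v + f s \<bullet> v) has_integral (u' a \<bullet> v - u' t \<bullet> v)) {a..t}"
    and \<iota>: "bounded_linear \<iota>" and \<iota>_le: "\<And>x. (norm (\<iota> x))\<^sup>2 \<le> C * (norm x)\<^sup>2"
    and pos: "0 \<le> C" "0 < m" "0 < c"
    and low: "\<And>s. s \<in> {a..<b} \<Longrightarrow> m * (norm (\<iota> (u' s)))\<^sup>2 \<le> f s \<bullet> u' s"
    and up: "\<And>s. s \<in> {a..<b} \<Longrightarrow> (norm (f s))\<^sup>2 \<le> C * M\<^sup>2 * (norm (\<iota> (u' s)))\<^sup>2"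
    and obs: "\<And>w w' w0 w1. wave_weak_sol DS S w w' w0 w1 \<Longrightarrow>
      ((norm (S w0))\<^sup>2 + (norm w1)\<^sup>2) / 2 \<le> c * integral {0..R} (\<lambda>s. (norm (\<iota> (w' s)))\<^sup>2)"
    and R: "0 \<le> R" "R \<le> b - a"
  defines "En \<equiv> \<lambda>t. ((norm (S (u t)))\<^sup>2 + (norm (u' t))\<^sup>2) / 2"
    and "k \<equiv> 2 * c * (1 + 4 * C\<^sup>2 * (b - a)\<^sup>2 * M\<^sup>2)"
  shows "\<And>t. t \<in> {a..b} \<Longrightarrow> En t \<le> En a" and "(m + k) * En b \<le> k * En a"
proof -
  define h where "h s = (norm (\<iota> (u' s)))\<^sup>2" for s
  have h: "continuous_on {a..b} h"
    unfolding h_def by (intro continuous_intros bounded_linear.continuous_on[OF \<iota>] u')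
  have int_h: "h integrable_on {p..q}" if "a \<le> p" "q \<le> b" for p q
    using that by (intro integrable_continuous_real continuous_on_subset[OF h]) auto
  have En_cont: "continuous_on {a..b} En"
    unfolding En_def by (intro continuous_intros Su u') auto
  define I where "I = integral {a..b} h"
  have h_sub: "integral {p..q} h \<le> I" if "a \<le> p" "q \<le> b" for p q
    unfolding I_def by (intro integral_subset_le int_h that) (use that in \<open>auto simp: h_def\<close>)
  have I_nonneg: "0 \<le> I" unfolding I_def by (intro integral_nonneg int_h) (auto simp: h_def)
  have en: "((\<lambda>s. f s \<bullet> u' s) has_integral (En a - En t)) {a..t}" if t: "t \<in> {a..<b}" for t
    unfolding En_def
  proof (rule wave_energy_identity[OF sa])
    show "(u has_vector_derivative u' r) (at r within {a..t})" if "r \<in> {a..t}" for r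
      using that t by (intro has_vector_derivative_within_subset[OF u_der]) auto
    show "continuous_on {a..t} (\<lambda>t. S (u t))" "continuous_on {a..t} u'" "continuous_on {a..t} f"
      using t by (auto intro: continuous_on_subset[OF Su] continuous_on_subset[OF u'] continuous_on_subset[OF f])
  qed (use t u_in weak in auto)
  have dec: "m * integral {a..t} h + En t \<le> En a" if t: "t \<in> {a..<b}" for t
  proof -
    have "((\<lambda>s. m * h s) has_integral m * integral {a..t} h) {a..t}"
      using t by (intro has_integral_mult_right integrable_integral int_h) auto
    from has_integral_le[OF this en[OF t]] have "m * integral {a..t} h \<le> En a - En t"
      using low t by (auto simp: h_def)
    then show ?thesis by simp
  qed
  have int_cont: "continuous_on {a..b} (\<lambda>t. integral {a..t} h)"
    by (rule indefinite_integral_continuous_1[OF int_h]) auto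
  have "continuous_on {a..b} (\<lambda>t. m * integral {a..t} h + En t)"
    by (intro continuous_intros En_cont int_cont)
  from continuous_le_at_right_end[OF this ab dec] have dec_b: "m * I + En b \<le> En a"
    by (simp only: I_def)
  show mono: "En t \<le> En a" if "t \<in> {a..b}" for t
  proof (cases "t = b")
    case True
    then show ?thesis using dec_b I_nonneg pos by (smt (verit) mult_nonneg_nonneg)
  next
    case False
    have "0 \<le> integral {a..t} h" using that by (intro integral_nonneg int_h) (auto simp: h_def)
    then have "0 \<le> m * integral {a..t} h" using pos by simp
    then show ?thesis using dec[of t] that False by auto
  qed
  have "u a \<in> DS" using u_in[of a] ab by simp
  from wave_weak_sol_exists[OF sa this]
  obtain w w' where w: "wave_weak_sol DS S w w' (u a) (u' a)" by blast
  then have w_in: "\<And>t. 0 \<le> t \<Longrightarrow> w t \<in> DS" and Sw: "continuous_on {0..} (\<lambda>t. S (w t))"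
    and w_der: "\<And>t. 0 \<le> t \<Longrightarrow> (w has_vector_derivative w' t) (at t within {0..})"
    and w': "continuous_on {0..} w'" and w0: "w 0 = u a" "w' 0 = u' a"
    and w_weak: "\<And>v t. v \<in> DS \<Longrightarrow> 0 \<le> t \<Longrightarrow>
      ((\<lambda>s. S (w s) \<bullet> S v) has_integral (u' a \<bullet> v - w' t \<bullet> v)) {0..t}"
    unfolding wave_weak_sol_def by auto
  \<comment> \<open>The difference to the free wave restarted at time a has zero data there and is
    forced by f alone, so \<open>wave_velocity_bound\<close> applies.\<close>
  define z where "z s = u s - w (s - a)" for s
  define z' where "z' s = u' s - w' (s - a)" for s
  have shift_cont: "continuous_on {a..b} (\<lambda>s. g (s - a))" if "continuous_on {0..} g" for g :: "real \<Rightarrow> 'h"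
    by (rule continuous_on_compose2[OF that]) (auto intro!: continuous_intros)
  have z'_cont: "continuous_on {a..b} z'"
    unfolding z'_def by (intro continuous_intros u' shift_cont w')
  have Sz: "S (z s) = S (u s) - S (w (s - a))" if "s \<in> {a..b}" for s
    unfolding z_def using that by (intro self_adjoint_diff[OF sa] u_in w_in) auto
  have Sz_cont: "continuous_on {a..b} (\<lambda>s. S (z s))"
    using continuous_on_diff[OF Su shift_cont[OF Sw]] by (rule continuous_on_eq) (simp add: Sz)
  \<comment> \<open>The 4 is the square of the 2 in \<open>wave_velocity_bound\<close>, b - a comes
    from Cauchy-Schwarz in time, and C M^2 from \<open>up\<close>.\<close>
  have vel: "(norm (z' t))\<^sup>2 \<le> 4 * (b - a) * C * M\<^sup>2 * I" if t: "t \<in> {a..<b}" for t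
  proof -
    have sub: "{a..t} \<subseteq> {a..b}" "{a..t} \<subseteq> {a..<b}" using t by auto
    have ft: "continuous_on {a..t} f" by (rule continuous_on_subset[OF f sub(2)])
    have "norm (z' t) \<le> 2 * integral {a..t} (\<lambda>s. norm (f s))"
    proof (rule wave_velocity_bound[OF sa, where u = z])
      show "z r \<in> DS" if "r \<in> {a..t}" for r
        unfolding z_def using that t
        by (intro subspace_diff[OF self_adjoint_opD(1)[OF sa]] u_in w_in) auto
      show "continuous_on {a..t} (\<lambda>s. S (z s))" by (rule continuous_on_subset[OF Sz_cont sub(1)])
      show "continuous_on {a..t} z'" by (rule continuous_on_subset[OF z'_cont sub(1)])
      show "(z has_vector_derivative z' r) (at r within {a..t})" if r: "r \<in> {a..t}" for r
      proof -
        have 1: "(u has_vector_derivative u' r) (at r within {a..t})"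
          using r t by (intro has_vector_derivative_within_subset[OF u_der]) auto
        have "((\<lambda>s. s - a) has_vector_derivative 1) (at r within {a..t})"
          by (auto intro!: derivative_eq_intros)
        moreover have "(w has_vector_derivative w' (r - a)) (at (r - a) within (\<lambda>s. s - a) ` {a..t})"
          using r by (intro has_vector_derivative_within_subset[OF w_der]) auto
        ultimately have "(w \<circ> (\<lambda>s. s - a) has_vector_derivative 1 *\<^sub>R w' (r - a)) (at r within {a..t})"
          by (rule vector_diff_chain_within)
        then have 2: "((\<lambda>s. w (s - a)) has_vector_derivative w' (r - a)) (at r within {a..t})"
          by (simp add: o_def)
        show ?thesis unfolding z_def[abs_def] z'_def by (intro derivative_intros 1 2)
      qed
      show "((\<lambda>s. S (z s) \<bullet> S v + f s \<bullet> v) has_integral (z' a \<bullet> v - z' r \<bullet> v)) {a..r}"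
        if v: "v \<in> DS" and r: "r \<in> {a..t}" for v r
      proof -
        have "((\<lambda>s. S (w s) \<bullet> S v) has_integral (u' a \<bullet> v - w' (r - a) \<bullet> v)) {0..r - a}"
          using w_weak[OF v, of "r - a"] r by simp
        then have "(((\<lambda>s. S (w (s - a)) \<bullet> S v) \<circ> (+) a) has_integral (u' a \<bullet> v - w' (r - a) \<bullet> v)) {0..r - a}"
          by (simp add: o_def)
        then have "((\<lambda>s. S (w (s - a)) \<bullet> S v) has_integral (u' a \<bullet> v - w' (r - a) \<bullet> v)) {a..r}"
          unfolding has_integral_shift_Icc_real by simp
        moreover have "((\<lambda>s. S (u s) \<bullet> S v + f s \<bullet> v) has_integral (u' a \<bullet> v - u' r \<bullet> v)) {a..r}"
          using r t by (intro weak v) auto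
        ultimately have "((\<lambda>s. (S (u s) \<bullet> S v + f s \<bullet> v) - S (w (s - a)) \<bullet> S v) has_integral
            ((u' a \<bullet> v - u' r \<bullet> v) - (u' a \<bullet> v - w' (r - a) \<bullet> v))) {a..r}"
          using has_integral_diff by blast
        then have "((\<lambda>s. S (z s) \<bullet> S v + f s \<bullet> v) has_integral
            ((u' a \<bullet> v - u' r \<bullet> v) - (u' a \<bullet> v - w' (r - a) \<bullet> v))) {a..r}"
          by (rule has_integral_eq[rotated]) (use r t in \<open>auto simp: Sz inner_diff_left\<close>)
        moreover have "(u' a \<bullet> v - u' r \<bullet> v) - (u' a \<bullet> v - w' (r - a) \<bullet> v) = z' a \<bullet> v - z' r \<bullet> v"
          by (simp add: z'_def w0 inner_diff_left)
        ultimately show ?thesis by (simp only:)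
      qed
    qed (use t w0 ft in \<open>auto simp: z_def z'_def\<close>)
    moreover have "0 \<le> integral {a..t} (\<lambda>s. norm (f s))"
      by (intro integral_nonneg integrable_continuous_real continuous_intros ft) auto
    ultimately have "(norm (z' t))\<^sup>2 \<le> (2 * integral {a..t} (\<lambda>s. norm (f s)))\<^sup>2"
      by (intro power_mono) auto
    also have "\<dots> \<le> 4 * ((t - a) * integral {a..t} (\<lambda>s. (norm (f s))\<^sup>2))"
      using integral_square_le[of a t "\<lambda>s. norm (f s)"] t ft
      by (simp add: power_mult_distrib continuous_on_norm)
    also have "\<dots> \<le> 4 * ((b - a) * (C * M\<^sup>2 * I))"
    proof (intro mult_left_mono mult_mono)
      have "integral {a..t} (\<lambda>s. (norm (f s))\<^sup>2) \<le> integral {a..t} (\<lambda>s. C * M\<^sup>2 * h s)"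
        using up t sub ft
        by (intro integral_le integrable_continuous_real continuous_intros continuous_on_subset[OF h])
          (auto simp: h_def)
      also have "\<dots> \<le> C * M\<^sup>2 * I"
        using h_sub[of a t] t pos by (simp add: mult_left_mono)
      finally show "integral {a..t} (\<lambda>s. (norm (f s))\<^sup>2) \<le> C * M\<^sup>2 * I" .
      show "0 \<le> integral {a..t} (\<lambda>s. (norm (f s))\<^sup>2)"
        by (intro integral_nonneg integrable_continuous_real continuous_intros ft) auto
    qed (use t in auto)
    also have "\<dots> = 4 * (b - a) * C * M\<^sup>2 * I" by (simp only: mult_ac)
    finally show ?thesis .
  qed
  have vel_b: "(norm (z' t))\<^sup>2 \<le> 4 * (b - a) * C * M\<^sup>2 * I" if "t \<in> {a..b}" for t
  proof (cases "t = b")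
    case True
    have "continuous_on {a..b} (\<lambda>t. (norm (z' t))\<^sup>2)" by (intro continuous_intros z'_cont)
    from continuous_le_at_right_end[OF this ab vel] show ?thesis by (simp only: True)
  qed (use vel that in auto)
  \<comment> \<open>By |x - y|^2 \<le> 2 |x|^2 + 2 |y|^2; the embedding costs one more C, so the
    velocity bound enters with 8 C^2.\<close>
  have w_le: "(norm (\<iota> (w' s)))\<^sup>2 \<le> 2 * h (a + s) + 8 * (b - a) * C\<^sup>2 * M\<^sup>2 * I" if s: "s \<in> {0..R}" for s
  proof -
    interpret \<iota>: bounded_linear \<iota> by (rule \<iota>)
    have "w' s = u' (a + s) - z' (a + s)" by (simp add: z'_def)
    then have "norm (\<iota> (w' s)) \<le> norm (\<iota> (u' (a + s))) + norm (\<iota> (z' (a + s)))"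
      by (simp add: \<iota>.diff norm_triangle_ineq4)
    then have "(norm (\<iota> (w' s)))\<^sup>2 \<le> (norm (\<iota> (u' (a + s))) + norm (\<iota> (z' (a + s))))\<^sup>2"
      by (intro power_mono) auto
    also have "\<dots> \<le> 2 * (norm (\<iota> (u' (a + s))))\<^sup>2 + 2 * (norm (\<iota> (z' (a + s))))\<^sup>2"
      using zero_le_power2[of "norm (\<iota> (u' (a + s))) - norm (\<iota> (z' (a + s)))"]
      by (simp add: power2_eq_square algebra_simps)
    also have "\<dots> \<le> 2 * h (a + s) + 2 * (C * (4 * (b - a) * C * M\<^sup>2 * I))"
      using order_trans[OF \<iota>_le mult_left_mono[OF vel_b pos(1)], of "a + s"] s R by (auto simp: h_def)
    finally show ?thesis by (simp add: power2_eq_square mult_ac)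
  qed
  have "En a \<le> c * integral {0..R} (\<lambda>s. (norm (\<iota> (w' s)))\<^sup>2)"
    using obs[OF w] by (simp add: En_def)
  also have "\<dots> \<le> c * (2 * I + R * (8 * (b - a) * C\<^sup>2 * M\<^sup>2 * I))"
  proof (rule mult_left_mono)
    have shift: "((\<lambda>s. h (a + s)) has_integral integral {a..a + R} h) {0..R}"
    proof -
      have "((h \<circ> (+) a) has_integral integral {a..a + R} h) {0..R}"
        unfolding has_integral_shift_Icc_real
        using integrable_integral[OF int_h[of a "a + R"]] R by (simp add: add.commute)
      then show ?thesis by (simp add: o_def)
    qed
    have const: "((\<lambda>s. 8 * (b - a) * C\<^sup>2 * M\<^sup>2 * I) has_integral R * (8 * (b - a) * C\<^sup>2 * M\<^sup>2 * I)) {0..R}"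
      using has_integral_const_real[of "8 * (b - a) * C\<^sup>2 * M\<^sup>2 * I" 0 R] R by simp
    have "(\<lambda>s. (norm (\<iota> (w' s)))\<^sup>2) integrable_on {0..R}"
      by (intro integrable_continuous_real continuous_intros bounded_linear.continuous_on[OF \<iota>]
          continuous_on_subset[OF w']) auto
    from has_integral_le[OF integrable_integral[OF this]
        has_integral_add[OF has_integral_mult_right[OF shift, of 2] const]]
    have "integral {0..R} (\<lambda>s. (norm (\<iota> (w' s)))\<^sup>2)
        \<le> 2 * integral {a..a + R} h + R * (8 * (b - a) * C\<^sup>2 * M\<^sup>2 * I)"
      using w_le by blast
    then show "integral {0..R} (\<lambda>s. (norm (\<iota> (w' s)))\<^sup>2) \<le> 2 * I + R * (8 * (b - a) * C\<^sup>2 * M\<^sup>2 * I)"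
      using h_sub[of a "a + R"] R by simp
  qed (use pos in simp)
  also have "\<dots> \<le> c * (2 * I + (b - a) * (8 * (b - a) * C\<^sup>2 * M\<^sup>2 * I))"
    using pos R ab I_nonneg by (intro mult_left_mono add_left_mono mult_right_mono) auto
  also have "\<dots> = k * I" by (simp add: k_def power2_eq_square algebra_simps)
  finally have E_le: "En a \<le> k * I" .
  have k: "0 \<le> k" using pos by (simp add: k_def)
  \<comment> \<open>Eliminate I between E(a) \<le> k I and m I \<le> E(a) - E(b); afterwards E(a) on
    the left is weakened to E(b).\<close>
  have "m * En a \<le> m * (k * I)" using E_le pos by (intro mult_left_mono) auto
  also have "\<dots> = k * (m * I)" by simp
  also have "\<dots> \<le> k * (En a - En b)" using dec_b k by (intro mult_left_mono) auto
  finally have "m * En a \<le> k * (En a - En b)" .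
  moreover have "m * En b \<le> m * En a" using mono[of b] ab pos by (intro mult_left_mono) auto
  ultimately show "(m + k) * En b \<le> k * En a" by (simp add: algebra_simps)
qed

section \<open>Gronwall estimates, without and with delay\<close>

lemma gronwall_integral:
  fixes \<phi> :: "real \<Rightarrow> real"
  assumes \<phi>: "continuous_on {a..b} \<phi>" and k: "0 \<le> k"
    and le: "\<And>t. t \<in> {a..b} \<Longrightarrow> \<phi> t \<le> \<alpha> + k * integral {a..t} \<phi>"
    and t: "t \<in> {a..b}"
  shows "\<phi> t \<le> \<alpha> * exp (k * (t - a))"
proof -
  \<comment> \<open>The right side of \<open>le\<close> times the integrating factor: its derivative
    is a nonnegative multiple of \<phi> minus that right side, so it is nonincreasing.\<close>
  define \<Psi> where "\<Psi> s = exp (- (k * (s - a))) * (\<alpha> + k * integral {a..s} \<phi>)" for s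
  have sub: "{a..t} \<subseteq> {a..b}" using t by auto
  have \<phi>t: "continuous_on {a..t} \<phi>" by (rule continuous_on_subset[OF \<phi> sub])
  have "\<Psi> a \<ge> \<Psi> t"
  proof (rule DERIV_nonpos_imp_decreasing_open[of a t \<Psi>])
    show "a \<le> t" using t by simp
    have "continuous_on {a..t} (\<lambda>s. integral {a..s} \<phi>)"
      by (intro indefinite_integral_continuous_1 integrable_continuous_real \<phi>t)
    then show "continuous_on {a..t} \<Psi>" unfolding \<Psi>_def by (intro continuous_intros)
    fix x assume x: "a < x" "x < t"
    have "((\<lambda>s. integral {a..s} \<phi>) has_real_derivative \<phi> x) (at x within {a..t})"
      using x by (intro integral_has_real_derivative \<phi>t) auto
    then have d: "((\<lambda>s. integral {a..s} \<phi>) has_real_derivative \<phi> x) (at x)"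
      using at_within_Icc_at[OF x] by simp
    have "(\<Psi> has_real_derivative
        exp (- (k * (x - a))) * (k * (\<phi> x - (\<alpha> + k * integral {a..x} \<phi>)))) (at x)"
      unfolding \<Psi>_def[abs_def]
      by (rule DERIV_cong[OF DERIV_mult[OF DERIV_chain2[OF DERIV_exp DERIV_minus[OF DERIV_cmult[OF
              DERIV_diff[OF DERIV_ident DERIV_const]]]] DERIV_add[OF DERIV_const DERIV_cmult[OF d]]]])
        (simp add: algebra_simps)
    moreover have "exp (- (k * (x - a))) * (k * (\<phi> x - (\<alpha> + k * integral {a..x} \<phi>))) \<le> 0"
      using le[of x] x t k by (intro mult_nonneg_nonpos) auto
    ultimately show "\<exists>y. (\<Psi> has_real_derivative y) (at x) \<and> y \<le> 0" by blast
  qed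
  then have "exp (- (k * (t - a))) * (\<alpha> + k * integral {a..t} \<phi>) \<le> \<alpha>" by (simp add: \<Psi>_def)
  then have "exp (k * (t - a)) * (exp (- (k * (t - a))) * (\<alpha> + k * integral {a..t} \<phi>))
      \<le> exp (k * (t - a)) * \<alpha>" by (intro mult_left_mono) auto
  moreover have "exp x * (exp (- x) * y) = y" for x y :: real
    by (simp add: mult.assoc[symmetric] flip: exp_add)
  ultimately have "\<alpha> + k * integral {a..t} \<phi> \<le> exp (k * (t - a)) * \<alpha>" by (simp only:)
  also have "\<dots> = \<alpha> * exp (k * (t - a))" by (rule mult.commute)
  finally have "\<alpha> + k * integral {a..t} \<phi> \<le> \<alpha> * exp (k * (t - a))" .
  then show ?thesis using le[OF t] by linarith
qed

text \<open>Shifted by \<tau>, the delayed integral splits into a history part, at most (b - a) A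
  however \<tau> compares with the length, and a part dominated by the integral of \<phi> from a.
  The history joins the initial value q A; the doubled integral gives the exponent 2
  \<kappa>.\<close>

lemma delayed_gronwall:
  fixes \<phi> :: "real \<Rightarrow> real"
  assumes \<phi>: "continuous_on {a - \<tau>..b} \<phi>" and \<tau>: "0 < \<tau>" and \<kappa>: "0 \<le> \<kappa>"
    and nonneg: "\<And>t. t \<in> {a - \<tau>..b} \<Longrightarrow> 0 \<le> \<phi> t"
    and le: "\<And>t. t \<in> {a..b} \<Longrightarrow> \<phi> t \<le> q * A + \<kappa> * integral {a..t} (\<lambda>s. \<phi> s + \<phi> (s - \<tau>))"
    and past: "\<And>t. t \<in> {a - \<tau>..a} \<Longrightarrow> \<phi> t \<le> A" and A: "0 \<le> A" and q: "0 \<le> q"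
    and t: "t \<in> {a..b}"
  shows "\<phi> t \<le> (q + \<kappa> * (b - a)) * exp (2 * \<kappa> * (b - a)) * A"
proof -
  have \<phi>ab: "continuous_on {a..b} \<phi>" using \<tau> by (intro continuous_on_subset[OF \<phi>]) auto
  have int: "\<phi> integrable_on {p..r}" if "a - \<tau> \<le> p" "r \<le> b" for p r
    using that by (intro integrable_continuous_real continuous_on_subset[OF \<phi>]) auto
  have hist: "integral {p..r} \<phi> \<le> (r - p) * A" if "a - \<tau> \<le> p" "p \<le> r" "r \<le> a" "r \<le> b" for p r
  proof -
    have "((\<lambda>s. A) has_integral (r - p) * A) {p..r}"
      using has_integral_const_real[of A p r] that by simp
    then show ?thesis
      using that past by (intro has_integral_le[OF integrable_integral[OF int]]) auto
  qed
  have delayed: "((\<lambda>s. \<phi> (s - \<tau>)) has_integral integral {a - \<tau>..r - \<tau>} \<phi>) {a..r}"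
    if "r \<in> {a..b}" for r
  proof -
    have "((\<phi> \<circ> (+) (- \<tau>)) has_integral integral {a - \<tau>..r - \<tau>} \<phi>) {a..r}"
      unfolding has_integral_shift_Icc_real
      using integrable_integral[OF int[of "a - \<tau>" "r - \<tau>"]] that \<tau> by simp
    then show ?thesis by (simp add: o_def)
  qed
  have delayed_le: "integral {a - \<tau>..r - \<tau>} \<phi> \<le> (b - a) * A + integral {a..r} \<phi>"
    if r: "r \<in> {a..b}" for r
  proof (cases "r - \<tau> \<le> a")
    case True
    have "integral {a - \<tau>..r - \<tau>} \<phi> \<le> (r - \<tau> - (a - \<tau>)) * A"
      using r \<tau> True by (intro hist) auto
    moreover have "(r - \<tau> - (a - \<tau>)) * A \<le> (b - a) * A" using r A by (intro mult_right_mono) auto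
    moreover have "0 \<le> integral {a..r} \<phi>"
      using r \<tau> by (intro integral_nonneg int nonneg) auto
    ultimately show ?thesis by linarith
  next
    case False
    have "integral {a - \<tau>..r - \<tau>} \<phi> = integral {a - \<tau>..a} \<phi> + integral {a..r - \<tau>} \<phi>"
      using r \<tau> False
      by (intro Henstock_Kurzweil_Integration.integral_combine[symmetric] int) auto
    moreover have "integral {a - \<tau>..a} \<phi> \<le> (a - (a - \<tau>)) * A"
      using r \<tau> False by (intro hist) auto
    moreover have "(a - (a - \<tau>)) * A \<le> (b - a) * A"
      using r A False by (intro mult_right_mono) auto
    moreover have "integral {a..r - \<tau>} \<phi> \<le> integral {a..r} \<phi>"
      using r \<tau> nonneg by (intro integral_subset_le int) auto
    ultimately show ?thesis by linarith
  qed
  have "\<phi> t \<le> (q + \<kappa> * (b - a)) * A * exp (2 * \<kappa> * (t - a))"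
  proof (rule gronwall_integral[OF \<phi>ab _ _ t])
    fix r assume r: "r \<in> {a..b}"
    have "integral {a..r} (\<lambda>s. \<phi> s + \<phi> (s - \<tau>)) = integral {a..r} \<phi> + integral {a - \<tau>..r - \<tau>} \<phi>"
      using r \<tau> by (intro integral_unique has_integral_add integrable_integral int delayed) auto
    also have "\<dots> \<le> (b - a) * A + 2 * integral {a..r} \<phi>" using delayed_le[OF r] by simp
    finally have "\<kappa> * integral {a..r} (\<lambda>s. \<phi> s + \<phi> (s - \<tau>)) \<le> \<kappa> * ((b - a) * A + 2 * integral {a..r} \<phi>)"
      using \<kappa> by (rule mult_left_mono)
    then show "\<phi> r \<le> (q + \<kappa> * (b - a)) * A + 2 * \<kappa> * integral {a..r} \<phi>"
      using le[OF r] by (simp add: algebra_simps)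
  qed (use \<kappa> in simp)
  also have "\<dots> \<le> (q + \<kappa> * (b - a)) * A * exp (2 * \<kappa> * (b - a))"
    using t \<kappa> A q by (intro mult_left_mono) (auto intro!: mult_left_mono)
  finally show ?thesis by (simp add: mult_ac)
qed

section \<open>Continuity and size of the feedback operators\<close>

lemma adjoint_apply_continuous:
  fixes B :: "real \<Rightarrow> 'u::real_inner \<Rightarrow>\<^sub>L 'h::real_inner"
  assumes adj: "\<And>s x y. blinfun_apply (B s) x \<bullet> y = x \<bullet> Badj s y"
    and B: "continuous_on I B" and g: "continuous_on I g"
  shows "continuous_on I (\<lambda>s. Badj s (g s))"
  unfolding continuous_on_def
proof
  fix s assume s: "s \<in> I"
  have bound: "norm (Badj r (g r) - Badj s (g s)) \<le> norm (B r - B s) * norm (g r) + norm (B s) * norm (g r - g s)" for r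
  proof -
    \<comment> \<open>\<open>Badj\<close> is given through the adjoint relation; pairing the
      difference with itself moves everything onto B, which is norm continuous.\<close>
    define d where "d = Badj r (g r) - Badj s (g s)"
    have "d \<bullet> d = blinfun_apply (B r) d \<bullet> g r - blinfun_apply (B s) d \<bullet> g s"
      by (simp add: d_def inner_diff_right adj)
    also have "\<dots> = blinfun_apply (B r - B s) d \<bullet> g r + blinfun_apply (B s) d \<bullet> (g r - g s)"
      by (simp add: blinfun.diff_left inner_diff_left inner_diff_right)
    also have "\<dots> \<le> norm (blinfun_apply (B r - B s) d) * norm (g r) + norm (blinfun_apply (B s) d) * norm (g r - g s)"
      by (intro add_mono norm_cauchy_schwarz)
    also have "\<dots> \<le> (norm (B r - B s) * norm d) * norm (g r) + (norm (B s) * norm d) * norm (g r - g s)"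
      by (intro add_mono mult_right_mono norm_blinfun) auto
    finally have "norm d * norm d \<le> norm d * (norm (B r - B s) * norm (g r) + norm (B s) * norm (g r - g s))"
      by (simp add: dot_square_norm power2_eq_square algebra_simps)
    then show ?thesis
      unfolding d_def[symmetric] by (cases "d = 0") (auto simp: mult_le_cancel_left)
  qed
  have B_lim: "(B \<longlongrightarrow> B s) (at s within I)" and g_lim: "(g \<longlongrightarrow> g s) (at s within I)"
    using B g s by (auto simp: continuous_on_def)
  have "((\<lambda>r. norm (B r - B s) * norm (g r) + norm (B s) * norm (g r - g s)) \<longlongrightarrow>
      norm (B s - B s) * norm (g s) + norm (B s) * norm (g s - g s)) (at s within I)"
    by (intro tendsto_intros B_lim g_lim)
  then have "((\<lambda>r. norm (B r - B s) * norm (g r) + norm (B s) * norm (g r - g s)) \<longlongrightarrow> 0) (at s within I)"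
    by simp
  then have "((\<lambda>r. Badj r (g r) - Badj s (g s)) \<longlongrightarrow> 0) (at s within I)"
    by (rule Lim_null_comparison[OF always_eventually, rotated]) (use bound in blast)
  then show "((\<lambda>r. Badj r (g r)) \<longlongrightarrow> Badj s (g s)) (at s within I)"
    by (simp add: LIM_zero_iff)
qed

lemma feedback_continuous:
  fixes B :: "real \<Rightarrow> 'u::real_inner \<Rightarrow>\<^sub>L 'h::real_inner"
  assumes "\<And>s x y. blinfun_apply (B s) x \<bullet> y = x \<bullet> Badj s y"
    and "continuous_on I B" and "continuous_on I g"
  shows "continuous_on I (\<lambda>s. blinfun_apply (B s) (Badj s (g s)))"
  using assms adjoint_apply_continuous[OF assms]
  by (intro bounded_bilinear.continuous_on[OF bounded_bilinear_blinfun_apply]) auto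

text \<open>With f = B (Badj x), |f|^2 equals Badj x . Badj f. The bound \<open>le\<close> is used
  for x and, through the embedding, for f: hence M enters squared and C once.\<close>

lemma feedback_norm_bound:
  fixes B :: "'u::real_inner \<Rightarrow>\<^sub>L 'h::real_inner"
  assumes adj: "\<And>x y. blinfun_apply B x \<bullet> y = x \<bullet> Badj y"
    and le: "\<And>x. (norm (Badj x))\<^sup>2 \<le> M * (norm (\<iota> x))\<^sup>2"
    and \<iota>_le: "\<And>x. (norm (\<iota> x))\<^sup>2 \<le> C * (norm x)\<^sup>2" and M: "0 \<le> M" and C: "0 \<le> C"
  shows "(norm (blinfun_apply B (Badj x)))\<^sup>2 \<le> C * M\<^sup>2 * (norm (\<iota> x))\<^sup>2"
proof -
  define f where "f = blinfun_apply B (Badj x)"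
  have "f \<bullet> f = Badj x \<bullet> Badj f" by (simp add: f_def adj)
  also have "\<dots> \<le> norm (Badj x) * norm (Badj f)" by (rule norm_cauchy_schwarz)
  finally have "((norm f)\<^sup>2)\<^sup>2 \<le> (norm (Badj x) * norm (Badj f))\<^sup>2"
    by (intro power_mono) (auto simp: dot_square_norm)
  also have "\<dots> \<le> (norm (Badj x))\<^sup>2 * (M * (C * (norm f)\<^sup>2))"
    using order_trans[OF le mult_left_mono[OF \<iota>_le M], of f]
    by (simp add: power_mult_distrib mult_left_mono)
  also have "\<dots> \<le> (M * (norm (\<iota> x))\<^sup>2) * (M * (C * (norm f)\<^sup>2))"
    using M C by (intro mult_right_mono le) auto
  finally have "(norm f)\<^sup>2 * (norm f)\<^sup>2 \<le> (C * M\<^sup>2 * (norm (\<iota> x))\<^sup>2) * (norm f)\<^sup>2"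
    by (simp add: power2_eq_square mult_ac)
  then have "(norm f)\<^sup>2 \<le> C * M\<^sup>2 * (norm (\<iota> x))\<^sup>2" if "f \<noteq> 0"
    by (rule mult_right_le_imp_le) (use that in simp)
  then show ?thesis
    unfolding f_def[symmetric] using C by (cases "f = 0") auto
qed

text \<open>\<open>A\<close> bounds the energy over the history window, \<open>q * A\<close> the
  energy at \<open>a\<close>; keeping the two apart preserves the loss factor gained on the damped
  interval.\<close>

lemma delayed_interval:
  fixes u u' f :: "real \<Rightarrow> 'h::{real_inner,complete_space}"
  assumes sa: "self_adjoint_op DS S" and ab: "a < b" and \<tau>: "0 < \<tau>"
    and u_in: "\<And>t. t \<in> {a..b} \<Longrightarrow> u t \<in> DS"
    and Su: "continuous_on {a - \<tau>..b} (\<lambda>t. S (u t))"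
    and u_der: "\<And>t. t \<in> {a..b} \<Longrightarrow> (u has_vector_derivative u' t) (at t within {a..b})"
    and u': "continuous_on {a - \<tau>..b} u'" and f: "continuous_on {a..<b} f"
    and weak: "\<And>v t. v \<in> DS \<Longrightarrow> t \<in> {a..<b} \<Longrightarrow>
      ((\<lambda>s. S (u s) \<bullet> S v + f s \<bullet> v) has_integral (u' a \<bullet> v - u' t \<bullet> v)) {a..t}"
    and En: "\<And>t. En t = ((norm (S (u t)))\<^sup>2 + (norm (u' t))\<^sup>2) / 2"
    and low: "\<And>s. s \<in> {a..<b} \<Longrightarrow> - (\<kappa> * (En s + En (s - \<tau>))) \<le> f s \<bullet> u' s"
    and \<kappa>: "0 \<le> \<kappa>" and q: "0 \<le> q" and A: "0 \<le> A"
    and past: "\<And>t. t \<in> {a - \<tau>..a} \<Longrightarrow> En t \<le> A" and En_a: "En a \<le> q * A"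
    and t: "t \<in> {a..b}"
  shows "En t \<le> (q + \<kappa> * (b - a)) * exp (2 * \<kappa> * (b - a)) * A"
proof -
  have En_cont: "continuous_on {a - \<tau>..b} En"
    unfolding En by (intro continuous_intros Su u') auto
  have inside: "En r \<le> (q + \<kappa> * (b - a)) * exp (2 * \<kappa> * (b - a)) * A" if r: "r \<in> {a..<b}" for r
  proof -
    \<comment> \<open>The interval stops at r < b because f is continuous only on
      \<open>{a..<b}\<close>; the constant is enlarged to that of the full interval
      afterwards.\<close>
    have "En r \<le> (q + \<kappa> * (r - a)) * exp (2 * \<kappa> * (r - a)) * A"
    proof (rule delayed_gronwall[where \<phi> = En and \<tau> = \<tau>])
      show "continuous_on {a - \<tau>..r} En" by (rule continuous_on_subset[OF En_cont]) (use r in auto)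
      show "En s \<le> q * A + \<kappa> * integral {a..s} (\<lambda>s. En s + En (s - \<tau>))" if s: "s \<in> {a..r}" for s
      proof -
        have "((\<lambda>x. f x \<bullet> u' x) has_integral (En a - En s)) {a..s}"
          unfolding En
        proof (rule wave_energy_identity[OF sa])
          show "(u has_vector_derivative u' x) (at x within {a..s})" if "x \<in> {a..s}" for x
            using that s r by (intro has_vector_derivative_within_subset[OF u_der]) auto
          show "continuous_on {a..s} (\<lambda>t. S (u t))" "continuous_on {a..s} u'" "continuous_on {a..s} f"
            using s r \<tau>
            by (auto intro: continuous_on_subset[OF Su] continuous_on_subset[OF u'] continuous_on_subset[OF f])
        qed (use s r u_in weak in auto)
        from has_integral_neg[OF this]
        have neg: "((\<lambda>x. - (f x \<bullet> u' x)) has_integral (En s - En a)) {a..s}" by simp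
        have "continuous_on {a..s} (\<lambda>x. En (x - \<tau>))"
          by (rule continuous_on_compose2[OF En_cont])
            (use s r \<tau> in \<open>auto intro!: continuous_intros\<close>)
        then have "(\<lambda>x. En x + En (x - \<tau>)) integrable_on {a..s}"
          using s r \<tau>
          by (intro integrable_continuous_real continuous_intros continuous_on_subset[OF En_cont]) auto
        from has_integral_le[OF neg has_integral_mult_right[OF integrable_integral[OF this], of \<kappa>]]
        have "En s - En a \<le> \<kappa> * integral {a..s} (\<lambda>s. En s + En (s - \<tau>))"
          using low s r by fastforce
        then show ?thesis using En_a by simp
      qed
      show "0 \<le> En s" for s by (simp add: En)
    qed (use \<tau> \<kappa> past A q r in auto)
    also have "\<dots> \<le> (q + \<kappa> * (b - a)) * exp (2 * \<kappa> * (b - a)) * A"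
      using r \<kappa> q A by (intro mult_right_mono mult_mono add_left_mono) (auto intro!: mult_left_mono)
    finally show ?thesis .
  qed
  show ?thesis
  proof (cases "t = b")
    case True
    have "continuous_on {a..b} En" by (rule continuous_on_subset[OF En_cont]) (use \<tau> in auto)
    from continuous_le_at_right_end[OF this ab inside] show ?thesis by (simp only: True)
  qed (use inside t in auto)
qed

section \<open>Accumulation of the interval factors\<close>

lemma energy_decay:
  fixes En :: "real \<Rightarrow> real" and t a :: "nat \<Rightarrow> real"
  assumes nonneg: "\<And>s. 0 \<le> En s" and mono: "strict_mono t"
    and unbounded: "\<And>s. \<exists>n. s < t (2 * n + 2)"
    and inside: "\<And>n s. s \<in> {t (2 * n)..t (2 * n + 2)} \<Longrightarrow> En s \<le> max 1 (exp (a n)) * En (t (2 * n))"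
    and step: "\<And>n. En (t (2 * n + 2)) \<le> exp (a n) * En (t (2 * n))"
    and a: "filterlim (\<lambda>N. \<Sum>n<N. a n) at_bot sequentially"
  shows "(En \<longlongrightarrow> 0) at_top"
proof -
  define P where "P N = exp (\<Sum>n<N. a n) * En (t 0)" for N
  have P: "En (t (2 * N)) \<le> P N" for N
  proof (induction N)
    case (Suc N)
    have "En (t (2 * Suc N)) \<le> exp (a N) * En (t (2 * N))" using step[of N] by simp
    also have "\<dots> \<le> exp (a N) * P N" using Suc by (intro mult_left_mono) auto
    also have "\<dots> = P (Suc N)" by (simp add: P_def exp_add)
    finally show ?case .
  qed (simp add: P_def)
  have P_Suc: "P (Suc N) = exp (a N) * P N" for N by (simp add: P_def exp_add)
  have P_nonneg: "0 \<le> P N" for N by (simp add: P_def nonneg)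
  have "P \<longlonglongrightarrow> 0 * En (t 0)"
    unfolding P_def by (intro tendsto_mult tendsto_const filterlim_compose[OF exp_at_bot a])
  then have lim: "P \<longlonglongrightarrow> 0" by simp
  have "(\<lambda>N. P N + P (Suc N)) \<longlonglongrightarrow> 0 + 0" by (intro tendsto_add lim LIMSEQ_Suc)
  then have lim2: "(\<lambda>N. P N + P (Suc N)) \<longlonglongrightarrow> 0" by simp
  \<comment> \<open>The maximum with 1 covers the damped half of a pair, where only monotonicity is
    used even if the pair as a whole contracts. It is at most 1 + exp (a N), hence two consecutive
    values of P.\<close>
  have En_le: "En s \<le> P N + P (Suc N)" if "s \<in> {t (2 * N)..t (2 * N + 2)}" for s N
  proof -
    have "En s \<le> max 1 (exp (a N)) * En (t (2 * N))" using inside[OF that] .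
    also have "\<dots> \<le> (1 + exp (a N)) * P N"
      using P[of N] nonneg by (intro mult_mono) auto
    finally show ?thesis by (simp add: P_Suc algebra_simps)
  qed
  show ?thesis
  proof (rule tendstoI)
    fix e :: real assume "0 < e"
    then have "\<forall>\<^sub>F N in sequentially. P N + P (Suc N) < e" by (rule order_tendstoD(2)[OF lim2])
    then obtain N0 where N0: "\<And>N. N \<ge> N0 \<Longrightarrow> P N + P (Suc N) < e"
      unfolding eventually_sequentially by blast
    have "dist (En s) 0 < e" if s: "t (2 * N0) \<le> s" for s
    proof -
      \<comment> \<open>The index of the pair of intervals containing s: minimality gives t (2 k)
        \<le> s.\<close>
      define k where "k = (LEAST k. s < t (2 * k + 2))"
      have k: "s < t (2 * k + 2)" unfolding k_def using unbounded by (rule LeastI_ex)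
      then have "t (2 * N0) < t (2 * k + 2)" using s by linarith
      then have "N0 \<le> k" using strict_mono_less[OF mono] by simp
      have "t (2 * k) \<le> s"
      proof (cases k)
        case 0
        then show ?thesis using s \<open>N0 \<le> k\<close> by simp
      next
        case (Suc j)
        have "\<not> s < t (2 * j + 2)" using not_less_Least[of j "\<lambda>k. s < t (2 * k + 2)"] Suc k_def by simp
        then show ?thesis using Suc by simp
      qed
      then have "En s \<le> P k + P (Suc k)" using k by (intro En_le) auto
      then show ?thesis using N0[OF \<open>N0 \<le> k\<close>] nonneg[of s] by simp
    qed
    then show "\<forall>\<^sub>F s in at_top. dist (En s) 0 < e"
      using eventually_at_top_linorder by blast
  qed
qed

section \<open>Decay of the energy\<close>

theorem theorem3p17:
  fixes D :: "'h::{real_inner,complete_space} set" and A :: "'h \<Rightarrow> 'h"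
    and DS :: "'h set" and S :: "'h \<Rightarrow> 'h"
    and B1 :: "real \<Rightarrow> ('u1::{real_inner,complete_space} \<Rightarrow>\<^sub>L 'h)" and B1adj :: "real \<Rightarrow> 'h \<Rightarrow> 'u1"
    and B2 :: "real \<Rightarrow> ('u2::{real_inner,complete_space} \<Rightarrow>\<^sub>L 'h)" and B2adj :: "real \<Rightarrow> 'h \<Rightarrow> 'u2"
    and \<iota> :: "'h \<Rightarrow> 'w::{real_inner,complete_space}" and C :: real
    and t :: "nat \<Rightarrow> real" and \<tau> :: real
    and m M :: "nat \<Rightarrow> real" and Tbar c :: real
    and u u' :: "real \<Rightarrow> 'h" and u0 u1 :: 'h
  defines "T \<equiv> (\<lambda>n. t (Suc n) - t n)"
  defines "Tstar \<equiv> (INF n. T (2 * n))"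
  defines "chat \<equiv> (\<lambda>n. 2 * c * (1 + 4 * C\<^sup>2 * (T (2*n))\<^sup>2 * (M (2*n))\<^sup>2)
                     / (m (2*n) + 2 * c * (1 + 4 * C\<^sup>2 * (T (2*n))\<^sup>2 * (M (2*n))\<^sup>2)))"
  assumes A_sa: "self_adjoint_op D A" and A_pos: "positive_op D A" and A_coer: "coercive_op D A"
    and sqrtA: "pos_sqrt_op D A DS S"
    and B1_adj: "\<forall>s x y. blinfun_apply (B1 s) x \<bullet> y = x \<bullet> B1adj s y"
    and B2_adj: "\<forall>s x y. blinfun_apply (B2 s) x \<bullet> y = x \<bullet> B2adj s y"
    and B_prod: "\<forall>s>0. (\<forall>y. B1adj s y = 0) \<or> (\<forall>y. B2adj s y = 0)"
    and t0: "t 0 = 0" and t_mono: "strict_mono t"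
    and B2_zero: "\<forall>n. \<forall>s\<in>{t (2*n)..<t (2*n+1)}. B2 s = 0"
    and B1_zero: "\<forall>n. \<forall>s\<in>{t (2*n+1)..<t (2*n+2)}. B1 s = 0"
    and B1_C1: "\<forall>n. \<exists>F F'. (\<forall>s\<in>{t (2*n)..<t (2*n+1)}. F s = B1 s) \<and>
                  (\<forall>s\<in>{t (2*n)..t (2*n+1)}. (F has_vector_derivative F' s) (at s within {t (2*n)..t (2*n+1)})) \<and>
                  continuous_on {t (2*n)..t (2*n+1)} F'"
    and B2_C1: "\<forall>n. \<exists>F F'. (\<forall>s\<in>{t (2*n+1)..<t (2*n+2)}. F s = B2 s) \<and>
                  (\<forall>s\<in>{t (2*n+1)..t (2*n+2)}. (F has_vector_derivative F' s) (at s within {t (2*n+1)..t (2*n+2)})) \<and>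
                  continuous_on {t (2*n+1)..t (2*n+2)} F'"
    and W_emb: "linear \<iota>" "inj \<iota>" "\<forall>x. (norm (\<iota> x))\<^sup>2 \<le> C * (norm x)\<^sup>2"
    and cond_i: "\<forall>n. 0 < m (2*n) \<and> m (2*n) \<le> M (2*n) \<and>
                   (\<forall>x. \<forall>s\<in>{t (2*n)..<t (2*n+1)}.
                      m (2*n) * (norm (\<iota> x))\<^sup>2 \<le> (norm (B1adj s x))\<^sup>2 \<and>
                      (norm (B1adj s x))\<^sup>2 \<le> M (2*n) * (norm (\<iota> x))\<^sup>2)"
    and cond_ii: "\<forall>n. 0 < M (2*n+1) \<and>
                   (\<forall>x. \<forall>s\<in>{t (2*n+1)..<t (2*n+2)}.
                      (norm (B2adj s x))\<^sup>2 \<le> M (2*n+1) * (norm (\<iota> x))\<^sup>2)"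
    and tau_pos: "0 < \<tau>" and tau_le: "\<forall>n. \<tau> \<le> T (2*n)"
    and obs: "0 < Tbar \<and> (\<forall>T'>Tbar. \<exists>c'>0. \<forall>w w' w0 w1. wave_weak_sol DS S w w' w0 w1 \<longrightarrow>
                 ((norm (S w0))\<^sup>2 + (norm w1)\<^sup>2) / 2 \<le> c' * integral {0..T'} (\<lambda>s. (norm (\<iota> (w' s)))\<^sup>2))"
    and Tstar_gt: "Tstar > Tbar"
    and c_pos: "0 < c"
    and c_obs: "\<forall>w w' w0 w1. wave_weak_sol DS S w w' w0 w1 \<longrightarrow>
                 ((norm (S w0))\<^sup>2 + (norm w1)\<^sup>2) / 2 \<le> c * integral {0..Tstar} (\<lambda>s. (norm (\<iota> (w' s)))\<^sup>2)"
    and series: "filterlim (\<lambda>N. \<Sum>n<N. 2 * C * M (2*n+1) * T (2*n+1)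
                                   + ln (chat n + C * M (2*n+1) * T (2*n+1))) at_bot sequentially"
    and sol: "delay_weak_sol DS S B1 B1adj B2 B2adj \<tau> u u' u0 u1"
  shows "((\<lambda>s. ((norm (S (u s)))\<^sup>2 + (norm (u' s))\<^sup>2) / 2) \<longlongrightarrow> 0) at_top"
proof -
  define En where "En s = ((norm (S (u s)))\<^sup>2 + (norm (u' s))\<^sup>2) / 2" for s
  have En_nonneg: "0 \<le> En s" for s by (simp add: En_def)
  have "(En \<longlongrightarrow> 0) at_top"
  \<comment> \<open>On the trivial space the embedding inequality does not fix the sign of C; a
    nonzero vector forces C \<ge> 0.\<close>
  proof (cases "\<forall>x::'h. x = 0")
    case True
    then have "En s = 0" for s unfolding En_def by (metis add_0 div_0 norm_zero zero_power2)
    then show ?thesis by (simp add: tendsto_eventually)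
  next
    case False
    then obtain x :: 'h where "x \<noteq> 0" by blast
    have "0 \<le> C * (norm x)\<^sup>2" using W_emb(3) order_trans[OF zero_le_power2] by blast
    then have C: "0 \<le> C" using \<open>x \<noteq> 0\<close> by (simp add: zero_le_mult_iff)
    have \<iota>_le: "(norm (\<iota> x))\<^sup>2 \<le> C * (norm x)\<^sup>2" for x using W_emb(3) by blast
    have \<iota>: "bounded_linear \<iota>"
    proof (rule bounded_linear_intro)
      show "\<iota> (x + y) = \<iota> x + \<iota> y" "\<iota> (r *\<^sub>R x) = r *\<^sub>R \<iota> x" for x y r
        using W_emb(1) by (simp_all add: linear_add linear_scale)
      show "norm (\<iota> x) \<le> norm x * sqrt C" for x
        using real_sqrt_le_mono[OF \<iota>_le[of x]] by (simp add: real_sqrt_mult mult.commute)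
    qed
    have sa: "self_adjoint_op DS S" using sqrtA by (simp add: pos_sqrt_op_def)
    have u_in: "\<And>t. 0 \<le> t \<Longrightarrow> u t \<in> DS" and Su: "continuous_on {0..} (\<lambda>t. S (u t))"
      and u_der: "\<And>t. 0 \<le> t \<Longrightarrow> (u has_vector_derivative u' t) (at t within {0..})"
      and u': "continuous_on {0..} u'"
      and u_weak: "\<And>v t. v \<in> DS \<Longrightarrow> 0 \<le> t \<Longrightarrow>
        ((\<lambda>s. S (u s) \<bullet> S v + blinfun_apply (B1 s) (B1adj s (u' s)) \<bullet> v
          + blinfun_apply (B2 s) (B2adj s (u' (s - \<tau>))) \<bullet> v) has_integral (u1 \<bullet> v - u' t \<bullet> v)) {0..t}"
      using sol unfolding delay_weak_sol_def by auto
    have u_weak_Icc: "((\<lambda>s. S (u s) \<bullet> S v + blinfun_apply (B1 s) (B1adj s (u' s)) \<bullet> v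
          + blinfun_apply (B2 s) (B2adj s (u' (s - \<tau>))) \<bullet> v) has_integral (u' a \<bullet> v - u' r \<bullet> v)) {a..r}"
      if "v \<in> DS" "0 \<le> a" "a \<le> r" for v a r
      using has_integral_Icc_diff[OF u_weak[OF that(1,2)] u_weak[OF that(1), of r] that(2,3)] that by simp
    have t_less: "t k < t l" if "k < l" for k l using t_mono that by (simp add: strict_mono_less)
    have t_le: "t k \<le> t l" if "k \<le> l" for k l using t_mono that by (simp add: strict_mono_less_eq)
    have t_nonneg: "0 \<le> t k" for k using t_le[of 0 k] t0 by simp
    have T_pos: "0 < T k" for k using t_less[of k "Suc k"] by (simp add: T_def)
    have Tstar_le: "Tstar \<le> T (2 * n)" for n
      unfolding Tstar_def
      by (intro cINF_lower bdd_belowI[of _ 0]) (auto intro: less_imp_le[OF T_pos])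
    have Tstar_pos: "0 < Tstar" using obs Tstar_gt by linarith
    define K where "K n = 2 * c * (1 + 4 * C\<^sup>2 * (T (2*n))\<^sup>2 * (M (2*n))\<^sup>2)" for n
    have K_pos: "0 < K n" for n
      using c_pos by (auto simp: K_def intro!: mult_pos_pos add_pos_nonneg)
    have m_pos: "0 < m (2 * n)" for n using cond_i by blast
    have M_even: "0 \<le> M (2 * n)" for n using cond_i less_imp_le order_trans by (metis less_le_trans)
    have M_odd: "0 \<le> M (2 * n + 1)" for n using cond_ii less_imp_le by blast
    have chat: "chat n = K n / (m (2 * n) + K n)" for n by (simp add: chat_def K_def)
    have chat_pos: "0 < chat n" for n using K_pos[of n] m_pos[of n] by (simp add: chat)
    \<comment> \<open>Both parts are needed: monotonicity bounds the delay history of the next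
      interval, the end-point estimate supplies \<open>chat\<close>.\<close>
    have even: "(\<forall>s\<in>{t (2*n)..t (2*n+1)}. En s \<le> En (t (2*n))) \<and>
        (m (2*n) + K n) * En (t (2*n+1)) \<le> K n * En (t (2*n))" for n
    proof -
      let ?a = "t (2*n)" and ?b = "t (2*n+1)"
      let ?f = "\<lambda>s. blinfun_apply (B1 s) (B1adj s (u' s))"
      have sub: "{?a..?b} \<subseteq> {0..}" "{?a..<?b} \<subseteq> {0..}" using t_nonneg[of "2*n"] by auto
      have ab: "?a < ?b" by (rule t_less) simp
      \<comment> \<open>B1 is switched off at the right end, so it agrees with its smooth extension,
        and inherits continuity, only on the half-open interval.\<close>
      obtain F F' where F: "\<And>s. s \<in> {?a..<?b} \<Longrightarrow> F s = B1 s"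
        and F': "\<And>s. s \<in> {?a..?b} \<Longrightarrow> (F has_vector_derivative F' s) (at s within {?a..?b})"
        using B1_C1 by blast
      have "continuous_on {?a..?b} F"
        unfolding continuous_on_eq_continuous_within using has_vector_derivative_continuous[OF F'] by blast
      then have "continuous_on {?a..<?b} F" by (rule continuous_on_subset) auto
      then have B1_cont: "continuous_on {?a..<?b} B1" by (rule continuous_on_eq) (rule F)
      have f_cont: "continuous_on {?a..<?b} ?f"
        by (rule feedback_continuous[OF _ B1_cont continuous_on_subset[OF u' sub(2)]]) (use B1_adj in blast)
      have weak: "((\<lambda>s. S (u s) \<bullet> S v + ?f s \<bullet> v) has_integral (u' ?a \<bullet> v - u' r \<bullet> v)) {?a..r}"
        if v: "v \<in> DS" and r: "r \<in> {?a..<?b}" for v r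
      proof (rule has_integral_eq[OF _ u_weak_Icc[OF v t_nonneg]])
        show "?a \<le> r" using r by simp
        fix s assume "s \<in> {?a..r}"
        then have "s \<in> {?a..<?b}" using r by auto
        then have "B2 s = 0" using B2_zero by blast
        then show "S (u s) \<bullet> S v + ?f s \<bullet> v + blinfun_apply (B2 s) (B2adj s (u' (s - \<tau>))) \<bullet> v
          = S (u s) \<bullet> S v + ?f s \<bullet> v" by simp
      qed
      have der: "(u has_vector_derivative u' s) (at s within {?a..?b})" if "s \<in> {?a..?b}" for s
        using that sub by (intro has_vector_derivative_within_subset[OF u_der]) auto
      have in_DS: "u s \<in> DS" if "s \<in> {?a..?b}" for s using that sub by (intro u_in) auto
      have low: "m (2*n) * (norm (\<iota> (u' s)))\<^sup>2 \<le> ?f s \<bullet> u' s" if "s \<in> {?a..<?b}" for s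
      proof -
        have "?f s \<bullet> u' s = (norm (B1adj s (u' s)))\<^sup>2" using B1_adj by (simp add: power2_norm_eq_inner)
        then show ?thesis using cond_i that by auto
      qed
      have up: "(norm (?f s))\<^sup>2 \<le> C * (M (2*n))\<^sup>2 * (norm (\<iota> (u' s)))\<^sup>2" if "s \<in> {?a..<?b}" for s
        by (rule feedback_norm_bound) (use B1_adj cond_i that \<iota>_le M_even C in auto)
      have R: "0 \<le> Tstar" "Tstar \<le> ?b - ?a" using Tstar_pos Tstar_le[of n] by (auto simp: T_def)
      have k: "2 * c * (1 + 4 * C\<^sup>2 * (?b - ?a)\<^sup>2 * (M (2*n))\<^sup>2) = K n" by (simp add: K_def T_def)
      note di = damped_interval[OF sa ab in_DS continuous_on_subset[OF Su sub(1)] der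
          continuous_on_subset[OF u' sub(1)] f_cont weak \<iota> \<iota>_le C m_pos c_pos low up _ R,
          unfolded k, folded En_def]
      show ?thesis using di c_obs by blast
    qed
    have odd: "En s \<le> (chat n + C * M (2*n+1) * T (2*n+1)) * exp (2 * (C * M (2*n+1)) * T (2*n+1)) * En (t (2*n))"
      if s: "s \<in> {t (2*n+1)..t (2*n+2)}" for s n
    proof -
      let ?a = "t (2*n+1)" and ?b = "t (2*n+2)"
      let ?f = "\<lambda>s. blinfun_apply (B2 s) (B2adj s (u' (s - \<tau>)))"
      \<comment> \<open>Here the restriction on the delay acts: the history window before ?a lies in
        the preceding damped interval, where the energy is at most En (t (2n)).\<close>
      have \<tau>a: "t (2*n) \<le> ?a - \<tau>" using tau_le[THEN spec, of n] by (simp add: T_def)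
      then have \<tau>0: "0 \<le> ?a - \<tau>" using t_nonneg[of "2*n"] by linarith
      then have sub: "{?a - \<tau>..?b} \<subseteq> {0..}" "{?a..?b} \<subseteq> {0..}" using tau_pos by auto
      have ab: "?a < ?b" by (rule t_less) simp
      obtain F F' where F: "\<And>s. s \<in> {?a..<?b} \<Longrightarrow> F s = B2 s"
        and F': "\<And>s. s \<in> {?a..?b} \<Longrightarrow> (F has_vector_derivative F' s) (at s within {?a..?b})"
        using B2_C1 by blast
      have "continuous_on {?a..?b} F"
        unfolding continuous_on_eq_continuous_within using has_vector_derivative_continuous[OF F'] by blast
      then have "continuous_on {?a..<?b} F" by (rule continuous_on_subset) auto
      then have B2_cont: "continuous_on {?a..<?b} B2" by (rule continuous_on_eq) (rule F)
      have u'_delay: "continuous_on {?a..<?b} (\<lambda>s. u' (s - \<tau>))"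
        by (rule continuous_on_compose2[OF u']) (use \<tau>0 in \<open>auto intro!: continuous_intros\<close>)
      have f_cont: "continuous_on {?a..<?b} ?f"
        by (rule feedback_continuous[OF _ B2_cont u'_delay]) (use B2_adj in blast)
      have weak: "((\<lambda>s. S (u s) \<bullet> S v + ?f s \<bullet> v) has_integral (u' ?a \<bullet> v - u' r \<bullet> v)) {?a..r}"
        if v: "v \<in> DS" and r: "r \<in> {?a..<?b}" for v r
      proof (rule has_integral_eq[OF _ u_weak_Icc[OF v t_nonneg]])
        show "?a \<le> r" using r by simp
        fix s assume "s \<in> {?a..r}"
        then have "s \<in> {?a..<?b}" using r by auto
        then have "B1 s = 0" using B1_zero by blast
        then show "S (u s) \<bullet> S v + blinfun_apply (B1 s) (B1adj s (u' s)) \<bullet> v + ?f s \<bullet> v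
          = S (u s) \<bullet> S v + ?f s \<bullet> v" by simp
      qed
      have der: "(u has_vector_derivative u' s) (at s within {?a..?b})" if "s \<in> {?a..?b}" for s
        using that sub by (intro has_vector_derivative_within_subset[OF u_der]) auto
      have in_DS: "u s \<in> DS" if "s \<in> {?a..?b}" for s using that sub by (intro u_in) auto
      have low: "- (C * M (2*n+1) * (En r + En (r - \<tau>))) \<le> ?f r \<bullet> u' r" if r: "r \<in> {?a..<?b}" for r
      proof -
        let ?p = "B2adj r (u' (r - \<tau>))" and ?q = "B2adj r (u' r)"
        have B: "(norm (B2adj r y))\<^sup>2 \<le> C * M (2*n+1) * (norm y)\<^sup>2" for y
        proof -
          have "(norm (B2adj r y))\<^sup>2 \<le> M (2*n+1) * (norm (\<iota> y))\<^sup>2" using cond_ii r by blast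
          also have "\<dots> \<le> M (2*n+1) * (C * (norm y)\<^sup>2)" by (intro mult_left_mono \<iota>_le M_odd)
          finally show ?thesis by (simp add: mult_ac)
        qed
        have En_ge: "(norm (u' x))\<^sup>2 \<le> 2 * En x" for x by (simp add: En_def)
        have B': "(norm (B2adj r (u' x)))\<^sup>2 \<le> C * M (2*n+1) * (2 * En x)" for x
          by (rule order_trans[OF B]) (intro mult_left_mono En_ge mult_nonneg_nonneg C M_odd)
        \<comment> \<open>Young's inequality for the delayed and the current observation; the bound
          |u'|^2 \<le> 2 En matches the factor 2 of the cross term and leaves \<kappa> = C
          M.\<close>
        have "0 \<le> (?p + ?q) \<bullet> (?p + ?q)" by simp
        also have "\<dots> = (norm ?p)\<^sup>2 + (norm ?q)\<^sup>2 + 2 * (?p \<bullet> ?q)"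
          by (simp add: power2_norm_eq_inner inner_add_left inner_add_right inner_commute)
        also have "\<dots> \<le> C * M (2*n+1) * (2 * En (r - \<tau>)) + C * M (2*n+1) * (2 * En r) + 2 * (?p \<bullet> ?q)"
          by (intro add_mono B' order_refl)
        also have "?p \<bullet> ?q = ?f r \<bullet> u' r" using B2_adj by simp
        finally show ?thesis by (simp add: algebra_simps)
      qed
      have past: "En r \<le> En (t (2*n))" if "r \<in> {?a - \<tau>..?a}" for r
        using even[of n] that \<tau>a by auto
      have En_a: "En ?a \<le> chat n * En (t (2*n))"
        using even[of n] K_pos[of n] m_pos[of n] by (simp add: chat pos_le_divide_eq mult.commute)
      have T_eq: "T (2*n+1) = ?b - ?a" by (simp add: T_def)
      show ?thesis
        unfolding T_eq
        by (rule delayed_interval[OF sa ab tau_pos in_DS continuous_on_subset[OF Su sub(1)] der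
              continuous_on_subset[OF u' sub(1)] f_cont weak En_def low mult_nonneg_nonneg[OF C M_odd]
              less_imp_le[OF chat_pos] En_nonneg past En_a s])
    qed
    define a where "a n = 2 * C * M (2*n+1) * T (2*n+1) + ln (chat n + C * M (2*n+1) * T (2*n+1))" for n
    \<comment> \<open>The argument of the logarithm is positive, so the series term is exactly the
      logarithm of the factor in \<open>odd\<close>.\<close>
    have exp_a: "exp (a n) = (chat n + C * M (2*n+1) * T (2*n+1)) * exp (2 * (C * M (2*n+1)) * T (2*n+1))" for n
    proof -
      have "0 \<le> C * M (2*n+1) * T (2*n+1)"
        by (intro mult_nonneg_nonneg C M_odd less_imp_le[OF T_pos])
      then have "0 < chat n + C * M (2*n+1) * T (2*n+1)" using chat_pos[of n] by linarith
      then show ?thesis unfolding a_def exp_add by (simp only: exp_ln mult_ac)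
    qed
    show ?thesis
    proof (rule energy_decay[OF En_nonneg t_mono])
      \<comment> \<open>Every damped interval lasts at least Tstar > 0, so the switching times are
        unbounded.\<close>
      have "real n * Tstar \<le> t (2 * n)" for n
      proof (induction n)
        case (Suc n)
        have "t (2 * Suc n) \<ge> t (2 * n) + T (2 * n)" using t_le[of "Suc (2 * n)" "2 * Suc n"] by (simp add: T_def)
        then show ?case using Suc Tstar_le[of n] by (simp add: algebra_simps)
      qed (simp add: t_nonneg)
      moreover have "\<exists>n. s < real n * Tstar" for s using reals_Archimedean3[OF Tstar_pos] by blast
      ultimately show "\<exists>n. s < t (2 * n + 2)" for s
        using t_le[of "2 * n" "2 * n + 2" for n] by (meson le_add1 less_le_trans)
      show "En s \<le> max 1 (exp (a n)) * En (t (2 * n))" if s: "s \<in> {t (2 * n)..t (2 * n + 2)}" for n s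
      proof (cases "s \<le> t (2 * n + 1)")
        case True
        then have "En s \<le> 1 * En (t (2 * n))" using even[of n] s by simp
        also have "\<dots> \<le> max 1 (exp (a n)) * En (t (2 * n))" by (intro mult_right_mono En_nonneg) simp
        finally show ?thesis .
      next
        case False
        then have "En s \<le> exp (a n) * En (t (2 * n))" using odd[of s n] s unfolding exp_a by simp
        also have "\<dots> \<le> max 1 (exp (a n)) * En (t (2 * n))" by (intro mult_right_mono En_nonneg) simp
        finally show ?thesis .
      qed
      show "En (t (2 * n + 2)) \<le> exp (a n) * En (t (2 * n))" for n
        unfolding exp_a using t_le[of "2*n+1" "2*n+2"] by (intro odd) auto
      show "filterlim (\<lambda>N. \<Sum>n<N. a n) at_bot sequentially" using series by (simp add: a_def)
    qed
  qed
  then show ?thesis by (simp add: En_def[abs_def])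
qed

end
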